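(* Let $D\subset\mathbb C$ be the unit disc, let $W(z,\bar z,\eta)$ be $\bar\partial$-data localized in $D$ and satisfying the symmetry condition $W(-z,-\bar z,\eta)=W(z,\bar z,\eta)$, and let $W_{-1}$ be such that $\partial_\eta W_{-1}(z,\bar z,\eta)=W(z,\bar z,\eta)$. Let $S(z,\bar z,\mathbf t)=S_0+\widetilde S$, $\mathbf t=(t_1,t_3,t_5,\dots)$, be the solution of the nonlinear Beltrami equation $$S_{\bar z}=W(z,\bar z,S_z)$$ corresponding to the dispersionless BKP hierarchy. Then the function $$F(\mathbf t)=-\frac{1}{2\pi\mathrm i}\iint_D\Bigl(\tfrac12\widetilde S_{\bar z}(\mathbf t)\,\widetilde S_z(\mathbf t)-W_{-1}(z,\bar z,S_z(\mathbf t))\Bigr)\,dz\wedge d\bar z,$$ i.e. the action for the Beltrami problem evaluated on its solution, is a $\tau$-function of the dispersionless BKP hierarchy.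
   Context: Here $S_0(z,\mathbf t)=\sum_{n\ge0}t_{2n+1}z^{2n+1}$, and $\widetilde S$ is analytic in $z$ outside the unit disc, with expansion $\widetilde S=\sum_{i\ge1}\widetilde S_i(\mathbf t)z^{-i}$ at infinity. Subscripts $z,\bar z$ denote the derivatives $\partial_z,\partial_{\bar z}$. In the dispersionless BKP case only the odd times $t_{2n+1}$ are present and $S(-z,\mathbf t)=-S(z,\mathbf t)$. The B-type quasiclassical vertex operator is $$\mathcal D(z)=2\sum_{n=0}^\infty\frac{z^{-(2n+1)}}{2n+1}\frac{\partial}{\partial t_{2n+1}},\qquad |z|>1,$$ and a $\tau$-function of the dispersionless BKP hierarchy is a function $F(\mathbf t)$ characterized by the relation $\widetilde S(z,\mathbf t)=-\mathcal D(z)F(\mathbf t)$.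
   Formalization: As printed the claim is off by a factor 2: for W=1 on D one gets F=-t_1, so -D(z)F=2/z, while S̃=1/z outside D. The theorem states instead that F/2 is a τ-function, for solutions C² up to the circle and holomorphic in the times. *)

theory Defs
  imports "HOL-Complex_Analysis.Complex_Analysis"
begin

text \<open>
  A function of \<open>(z, z\<^sup>*)\<close> is a function of the single complex variable \<open>z\<close> that need not be
  holomorphic. The times \<open>(t\<^sub>1, t\<^sub>3, t\<^sub>5, \<dots>)\<close> are complex and are stored as a sequence \<open>t\<close> whose entry
  \<open>t n\<close> is the time with index \<open>2n+1\<close>; \<open>t(n := s)\<close> varies this one time.
\<close>

definition dz :: "(complex \<Rightarrow> complex) \<Rightarrow> complex \<Rightarrow> complex" where
  "dz f z = (frechet_derivative f (at z) 1 - \<i> * frechet_derivative f (at z) \<i>) / 2"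

definition dbar :: "(complex \<Rightarrow> complex) \<Rightarrow> complex \<Rightarrow> complex" where
  "dbar f z = (frechet_derivative f (at z) 1 + \<i> * frechet_derivative f (at z) \<i>) / 2"

text \<open>The integral against the 2-form \<open>dz \<and> dz\<^sup>* = -2\<i> dx \<and> dy\<close>.\<close>

definition wedge_integral :: "complex set \<Rightarrow> (complex \<Rightarrow> complex) \<Rightarrow> complex" where
  "wedge_integral A f = - 2 * \<i> * set_lebesgue_integral lebesgue A f"

text \<open>The exterior of the disc is \<open>norm z > 1\<close>, hence the disc is taken closed.\<close>

definition unit_disc :: "complex set" where
  "unit_disc = cball 0 1"

definition C1_on :: "('a::real_normed_vector \<Rightarrow> 'b::real_normed_vector) \<Rightarrow> 'a set \<Rightarrow> bool" where
  "C1_on f X \<longleftrightarrow>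
     (\<forall>x\<in>X. f differentiable (at x)) \<and>
     (\<forall>v. continuous_on X (\<lambda>x. frechet_derivative f (at x) v))"

definition C2_on :: "('a::real_normed_vector \<Rightarrow> 'b::real_normed_vector) \<Rightarrow> 'a set \<Rightarrow> bool" where
  "C2_on f X \<longleftrightarrow> C1_on f X \<and> (\<forall>v. C1_on (\<lambda>x. frechet_derivative f (at x) v) X)"

text \<open>Twice continuously differentiable up to the boundary of a set that need not be open.\<close>

definition C2_up_to_boundary :: "('a::real_normed_vector \<Rightarrow> 'b::real_normed_vector) \<Rightarrow> 'a set \<Rightarrow> bool"
  where "C2_up_to_boundary f A \<longleftrightarrow>
     (\<exists>X g. open X \<and> A \<subseteq> X \<and> C2_on g X \<and> (\<forall>x\<in>A. g x = f x))"

definition S0 :: "(nat \<Rightarrow> complex) \<Rightarrow> complex \<Rightarrow> complex" where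
  "S0 t z = (\<Sum>n. t n * z ^ (2 * n + 1))"

text \<open>
  A domain of times: \<open>S0\<close> converges there, and every single time can be varied in an open set, so
  that partial derivatives in the times make sense.
\<close>

definition time_domain :: "(nat \<Rightarrow> complex) set \<Rightarrow> bool" where
  "time_domain T \<longleftrightarrow>
     (\<forall>t\<in>T. (\<forall>z::complex. summable (\<lambda>n. t n * z ^ (2 * n + 1))) \<and>
            (\<forall>n. open {s. t(n := s) \<in> T}))"

definition localized_in_disc :: "(complex \<Rightarrow> complex \<Rightarrow> complex) \<Rightarrow> bool" where
  "localized_in_disc W \<longleftrightarrow> (\<forall>z \<eta>. z \<notin> unit_disc \<longrightarrow> W z \<eta> = 0)"

definition full_S :: "((nat \<Rightarrow> complex) \<Rightarrow> complex \<Rightarrow> complex) \<Rightarrow> (nat \<Rightarrow> complex) \<Rightarrow> complex \<Rightarrow> complex"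
  where "full_S St t z = S0 t z + St t z"

text \<open>
  The function \<open>St t\<close> is the correction to \<open>S0 t\<close>. The data \<open>W\<close> may jump across the unit circle;
  then so do the first derivatives of the continuous function \<open>St t\<close>, so the Beltrami equation is
  imposed off the circle and regularity is required inside (up to the circle), outside, and
  as continuity across.
\<close>

definition dBKP_beltrami_solution ::
  "(complex \<Rightarrow> complex \<Rightarrow> complex) \<Rightarrow> (nat \<Rightarrow> complex) set \<Rightarrow>
   ((nat \<Rightarrow> complex) \<Rightarrow> complex \<Rightarrow> complex) \<Rightarrow> bool" where
  "dBKP_beltrami_solution W T St \<longleftrightarrow>
     (\<forall>t\<in>T. continuous_on UNIV (St t) \<and>
            St t holomorphic_on (- unit_disc) \<and>
            (\<exists>c. \<forall>\<^sub>F z in at_infinity. (\<lambda>i. c i / z ^ Suc i) sums St t z) \<and>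
            (\<forall>z. full_S St t (- z) = - full_S St t z) \<and>
            (\<forall>z. norm z \<noteq> 1 \<longrightarrow> dbar (full_S St t) z = W z (dz (full_S St t) z)) \<and>
            (\<forall>n. C2_up_to_boundary (\<lambda>(z, s). St (t(n := s)) z) (unit_disc \<times> {s. t(n := s) \<in> T}) \<and>
                 (\<forall>z\<in>unit_disc. (\<lambda>s. St (t(n := s)) z) holomorphic_on {s. t(n := s) \<in> T})))"

definition beltrami_action ::
  "(complex \<Rightarrow> complex \<Rightarrow> complex) \<Rightarrow> ((nat \<Rightarrow> complex) \<Rightarrow> complex \<Rightarrow> complex) \<Rightarrow>
   (nat \<Rightarrow> complex) \<Rightarrow> complex" where
  "beltrami_action W1 St t =
     - (1 / (2 * of_real pi * \<i>)) *
       wedge_integral unit_disc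
         (\<lambda>z. 1 / 2 * dbar (St t) z * dz (St t) z - W1 z (dz (full_S St t) z))"

definition time_deriv :: "nat \<Rightarrow> ((nat \<Rightarrow> complex) \<Rightarrow> complex) \<Rightarrow> (nat \<Rightarrow> complex) \<Rightarrow> complex" where
  "time_deriv n F t = deriv (\<lambda>s. F (t(n := s))) (t n)"

definition B_vertex_operator ::
  "complex \<Rightarrow> ((nat \<Rightarrow> complex) \<Rightarrow> complex) \<Rightarrow> (nat \<Rightarrow> complex) \<Rightarrow> complex" where
  "B_vertex_operator z F t =
     2 * (\<Sum>n. 1 / (of_nat (2 * n + 1) * z ^ (2 * n + 1)) * time_deriv n F t)"

text \<open>
  The relation \<open>St = - B_vertex_operator F\<close>, including the existence of the derivatives and the
  convergence of the series. It says that the coefficient of \<open>1 / z ^ (2n+1)\<close> in \<open>St t z\<close> is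
  \<open>-2/(2n+1)\<close> times the derivative of \<open>F\<close> in the time with index \<open>2n+1\<close>. The factor 2 is the
  B-type normalization, in which a KP-type free energy restricted to the odd times is \<open>2F\<close>. The
  derivative of \<open>beltrami_action\<close> in that time is \<open>-(2n+1)\<close> times this coefficient, without the
  factor 2; so one half of \<open>beltrami_action\<close> has the B-type normalization.
\<close>

definition dBKP_tau_function ::
  "(nat \<Rightarrow> complex) set \<Rightarrow> ((nat \<Rightarrow> complex) \<Rightarrow> complex \<Rightarrow> complex) \<Rightarrow>
   ((nat \<Rightarrow> complex) \<Rightarrow> complex) \<Rightarrow> bool" where
  "dBKP_tau_function T St F \<longleftrightarrow>
     (\<forall>t\<in>T. (\<forall>n. (\<lambda>s. F (t(n := s))) field_differentiable (at (t n))) \<and>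
            (\<forall>z. norm z > 1 \<longrightarrow>
               summable (\<lambda>n. 1 / (of_nat (2 * n + 1) * z ^ (2 * n + 1)) * time_deriv n F t) \<and>
               St t z = - B_vertex_operator z F t))"

end

theory Submission
  imports Defs
begin

text \<open>
  Write \<open>S = St t\<close>, \<open>u\<close> for its derivative in the time of index \<open>2n+1\<close>, and \<open>d, d*\<close> for the
  derivatives in \<open>z, z\<^sup>*\<close>. Because \<open>d* S = W (z, d (S0 + S))\<close>, differentiating the action under the
  integral gives \<open>1/\<pi>\<close> times the integral over the disc of
  \<open>(d* u \<cdot> d S - d* S \<cdot> d u) / 2 - (2n+1) z\<^sup>2\<^sup>n \<cdot> d* S\<close>. By Green's theorem the first
  term is a multiple of the integral of \<open>u dS\<close> over the circle, which vanishes since \<open>u\<close> and \<open>S\<close>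
  have only negative Fourier modes there; the second one is \<open>-(2n+1)\<pi>\<close> times the coefficient of
  \<open>1 / z\<^sup>2\<^sup>n\<^sup>+\<^sup>1\<close> in \<open>S\<close>. Since \<open>S\<close> is odd, these coefficients determine it.
\<close>

section \<open>Symmetry of second derivatives\<close>

text \<open>No regularity of \<open>W\<close> or \<open>W1\<close> in \<open>z\<close> is assumed.
  The Beltrami equation makes up for it: once the chain rule has turned \<open>W1\<close> into
  \<open>W\<close>, the value of \<open>W\<close> is \<open>d* S\<close>, so the differentiated
  integrand involves only derivatives of \<open>S\<close> and powers of \<open>z\<close> and is
  bounded up to the circle. The circle is delicate, because \<open>S\<close> is smooth from inside
  but merely continuous across it. Green's theorem is therefore applied to a smooth extension from
  the closed disc, and only boundary values, which both sides share, are carried to the exterior.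
  Moreover, dependence on the time is controlled on the closed disc only, so it is not given that
  \<open>u\<close> continues holomorphically to the exterior. Orthogonality is proved instead for
  \<open>S\<close> at two different times and then differentiated in one of them. Symmetry of second
  derivatives enters twice: it passes holomorphy in the time from \<open>S\<close> to
  \<open>d S\<close> and \<open>d* S\<close>, and it makes the antisymmetric term a
  divergence.\<close>

lemma C1_on_has_derivative:
  assumes "C1_on f X" "x \<in> X"
  shows "(f has_derivative frechet_derivative f (at x)) (at x)"
  using assms by (auto simp: C1_on_def frechet_derivative_works)

text \<open>Two applications of the mean value theorem: in the direction \<open>v\<close> to the
  increment of \<open>g\<close> across a step in \<open>w\<close>, then in the direction
  \<open>w\<close> to the derivative along \<open>v\<close>. The double difference is symmetric in
  \<open>v\<close> and \<open>w\<close>, whereas the right-hand side is not; the symmetry proof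
  lives on this contrast.\<close>

lemma double_difference_mean_value:
  fixes g :: "'a::real_normed_vector \<Rightarrow> real"
  assumes h: "h > 0"
    and mem: "\<And>a b. a \<in> {0..h} \<Longrightarrow> b \<in> {0..h} \<Longrightarrow> x + a *\<^sub>R v + b *\<^sub>R w \<in> X"
    and g: "\<And>y. y \<in> X \<Longrightarrow> (g has_derivative g' y) (at y)"
    and gv: "\<And>y. y \<in> X \<Longrightarrow> ((\<lambda>y. g' y v) has_derivative g'' y) (at y)"
  obtains a b where "a \<in> {0..h}" "b \<in> {0..h}"
    "g (x + h *\<^sub>R v + h *\<^sub>R w) - g (x + h *\<^sub>R v) - g (x + h *\<^sub>R w) + g x =
      h\<^sup>2 * g'' (x + a *\<^sub>R v + b *\<^sub>R w) w"
proof -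
  have lin: "(f has_derivative f') F \<Longrightarrow> f' (t *\<^sub>R z) = t * f' z"
    for f :: "'a \<Rightarrow> real" and f' F t z
    using has_derivative_linear[of f f' F] by (simp add: linear_cmul)
  have der1: "((\<lambda>a. g (x + a *\<^sub>R v + b *\<^sub>R w)) has_real_derivative g' (x + a *\<^sub>R v + b *\<^sub>R w) v) (at a)"
    if "a \<in> {0..h}" "b \<in> {0..h}" for a b
  proof -
    have "((\<lambda>a. x + a *\<^sub>R v + b *\<^sub>R w) has_derivative (\<lambda>t. t *\<^sub>R v)) (at a)"
      by (auto intro!: derivative_eq_intros)
    from has_derivative_compose[OF this g[OF mem[OF that]]] lin[OF g[OF mem[OF that]]]
    show ?thesis by (simp add: has_field_derivative_def mult_commute_abs)
  qed
  have der2: "((\<lambda>b. g' (x + a *\<^sub>R v + b *\<^sub>R w) v) has_real_derivative g'' (x + a *\<^sub>R v + b *\<^sub>R w) w) (at b)"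
    if "a \<in> {0..h}" "b \<in> {0..h}" for a b
  proof -
    have "((\<lambda>b. x + a *\<^sub>R v + b *\<^sub>R w) has_derivative (\<lambda>t. t *\<^sub>R w)) (at b)"
      by (auto intro!: derivative_eq_intros)
    from has_derivative_compose[OF this gv[OF mem[OF that]]] lin[OF gv[OF mem[OF that]]]
    show ?thesis by (simp add: has_field_derivative_def mult_commute_abs)
  qed
  have "\<exists>a>0. a < h \<and> (g (x + h *\<^sub>R v + h *\<^sub>R w) - g (x + h *\<^sub>R v + 0 *\<^sub>R w)) -
      (g (x + 0 *\<^sub>R v + h *\<^sub>R w) - g (x + 0 *\<^sub>R v + 0 *\<^sub>R w)) =
      (h - 0) * (g' (x + a *\<^sub>R v + h *\<^sub>R w) v - g' (x + a *\<^sub>R v + 0 *\<^sub>R w) v)"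
    by (rule MVT2[OF h]) (intro DERIV_diff der1; use h in auto)
  then obtain a where a: "0 < a" "a < h"
    and eq1: "g (x + h *\<^sub>R v + h *\<^sub>R w) - g (x + h *\<^sub>R v) - (g (x + h *\<^sub>R w) - g x) =
      h * (g' (x + a *\<^sub>R v + h *\<^sub>R w) v - g' (x + a *\<^sub>R v + 0 *\<^sub>R w) v)"
    by auto
  have "\<exists>b>0. b < h \<and> g' (x + a *\<^sub>R v + h *\<^sub>R w) v - g' (x + a *\<^sub>R v + 0 *\<^sub>R w) v =
      (h - 0) * g'' (x + a *\<^sub>R v + b *\<^sub>R w) w"
    by (rule MVT2[OF h]) (intro der2; use a in auto)
  then obtain b where b: "0 < b" "b < h"
    and eq2: "g' (x + a *\<^sub>R v + h *\<^sub>R w) v - g' (x + a *\<^sub>R v + 0 *\<^sub>R w) v =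
      h * g'' (x + a *\<^sub>R v + b *\<^sub>R w) w"
    by auto
  show ?thesis
    by (rule that[of a b]) (use a b eq1[unfolded eq2] in \<open>auto simp: power2_eq_square\<close>)
qed

text \<open>Both mixed derivatives, at points of one small parallelogram, equal the same double
  difference divided by \<open>h\<^sup>2\<close>. Continuity then forbids a gap between them at
  \<open>x\<close>.\<close>

lemma symmetric_second_derivative_real:
  fixes g :: "'a::real_normed_vector \<Rightarrow> real"
  assumes "open X" "x \<in> X"
    and g: "\<And>y. y \<in> X \<Longrightarrow> (g has_derivative g' y) (at y)"
    and gv: "\<And>y. y \<in> X \<Longrightarrow> ((\<lambda>y. g' y v) has_derivative gv y) (at y)"
    and gw: "\<And>y. y \<in> X \<Longrightarrow> ((\<lambda>y. g' y w) has_derivative gw y) (at y)"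
    and cv: "continuous_on X (\<lambda>y. gv y w)" and cw: "continuous_on X (\<lambda>y. gw y v)"
  shows "gv x w = gw x v"
proof (rule ccontr)
  assume ne: "gv x w \<noteq> gw x v"
  \<comment> \<open>Half the gap: two errors below \<open>e\<close> cannot bridge it.\<close>
  define e where "e = \<bar>gv x w - gw x v\<bar> / 2"
  have e: "e > 0" using ne by (simp add: e_def)
  have "isCont (\<lambda>y. gv y w) x" "isCont (\<lambda>y. gw y v) x"
    using cv cw assms(1,2) by (auto simp: continuous_on_eq_continuous_at)
  then have "\<forall>\<^sub>F y in at x. dist (gv y w) (gv x w) < e" "\<forall>\<^sub>F y in at x. dist (gw y v) (gw x v) < e"
    using e by (auto simp: isCont_def tendsto_iff)
  then have "\<forall>\<^sub>F y in nhds x. y \<in> X \<and> dist (gv y w) (gv x w) < e \<and> dist (gw y v) (gw x v) < e"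
    using e eventually_nhds_in_open[OF assms(1,2)]
    by (auto simp: eventually_at_filter elim: eventually_elim2 intro!: eventually_conj)
  then obtain d where d: "d > 0" and near: "\<And>y. dist y x < d \<Longrightarrow>
      y \<in> X \<and> dist (gv y w) (gv x w) < e \<and> dist (gw y v) (gw x v) < e"
    by (auto simp: eventually_nhds_metric)
  \<comment> \<open>Small enough to keep the whole parallelogram within distance \<open>d\<close> of
    \<open>x\<close>; the summand 1 avoids a zero denominator when both directions vanish.\<close>
  define h where "h = d / (2 * (norm v + norm w + 1))"
  have pos: "norm v + norm w + 1 > 0" by (simp add: add_nonneg_pos)
  then have h: "h > 0" using d by (simp add: h_def)
  have close: "dist (x + a *\<^sub>R v + b *\<^sub>R w) x < d" if "a \<in> {0..h}" "b \<in> {0..h}" for a b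
  proof -
    have "dist (x + a *\<^sub>R v + b *\<^sub>R w) x \<le> norm (a *\<^sub>R v) + norm (b *\<^sub>R w)"
      using norm_triangle_ineq[of "a *\<^sub>R v" "b *\<^sub>R w"] by (simp add: dist_norm add.assoc)
    also have "\<dots> \<le> h * norm v + h * norm w"
      using that by (auto intro!: add_mono mult_right_mono)
    also have "\<dots> < 2 * (h * (norm v + norm w + 1))"
      using h by (auto simp: algebra_simps intro!: add_pos_nonneg add_nonneg_pos)
    also have "\<dots> = d"
      using pos by (simp add: h_def del: distrib_left_numeral)
    finally show ?thesis .
  qed
  obtain a b where ab: "a \<in> {0..h}" "b \<in> {0..h}"
    "g (x + h *\<^sub>R v + h *\<^sub>R w) - g (x + h *\<^sub>R v) - g (x + h *\<^sub>R w) + g x =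
      h\<^sup>2 * gv (x + a *\<^sub>R v + b *\<^sub>R w) w"
    by (rule double_difference_mean_value[OF h, of x v w X g g' gv]) (use close near g gv in auto)
  obtain b' a' where ab': "b' \<in> {0..h}" "a' \<in> {0..h}"
    "g (x + h *\<^sub>R w + h *\<^sub>R v) - g (x + h *\<^sub>R w) - g (x + h *\<^sub>R v) + g x =
      h\<^sup>2 * gw (x + b' *\<^sub>R w + a' *\<^sub>R v) v"
  proof (rule double_difference_mean_value[OF h, of x w v X g g' gw])
    fix b' a' assume "b' \<in> {0..h}" "a' \<in> {0..h}"
    then show "x + b' *\<^sub>R w + a' *\<^sub>R v \<in> X"
      using near[OF close[of a' b']] by (simp add: add_ac)
  qed (use g gw in auto)
  have "h\<^sup>2 * gv (x + a *\<^sub>R v + b *\<^sub>R w) w = h\<^sup>2 * gw (x + a' *\<^sub>R v + b' *\<^sub>R w) v"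
  proof -
    have eq: "x + h *\<^sub>R w + h *\<^sub>R v = x + h *\<^sub>R v + h *\<^sub>R w"
      "x + b' *\<^sub>R w + a' *\<^sub>R v = x + a' *\<^sub>R v + b' *\<^sub>R w"
      by (simp_all add: add_ac)
    show ?thesis using ab(3) ab'(3) unfolding eq by linarith
  qed
  then have "gv (x + a *\<^sub>R v + b *\<^sub>R w) w = gw (x + a' *\<^sub>R v + b' *\<^sub>R w) v"
    using h by simp
  moreover have "dist (gv (x + a *\<^sub>R v + b *\<^sub>R w) w) (gv x w) < e"
    using near[OF close[OF ab(1,2)]] by simp
  moreover have "dist (gw (x + a' *\<^sub>R v + b' *\<^sub>R w) v) (gw x v) < e"
    using near[OF close[OF ab'(2,1)]] by simp
  ultimately show False by (simp add: e_def dist_real_def abs_if split: if_splits)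
qed

text \<open>The mean value theorem needs real values, so the claim is tested against inner products
  with every vector \<open>c\<close>.\<close>

lemma C2_on_symmetric:
  fixes g :: "'a::real_normed_vector \<Rightarrow> 'b::real_inner"
  assumes "C2_on g X" "open X" "x \<in> X"
  shows "frechet_derivative (\<lambda>y. frechet_derivative g (at y) v) (at x) w =
    frechet_derivative (\<lambda>y. frechet_derivative g (at y) w) (at x) v"
proof -
  let ?D = "\<lambda>v y. frechet_derivative (\<lambda>y. frechet_derivative g (at y) v) (at y)"
  have C: "C1_on g X" "\<And>v. C1_on (\<lambda>x. frechet_derivative g (at x) v) X"
    using assms(1) by (auto simp: C2_on_def)
  have d1: "((\<lambda>y. g y \<bullet> c) has_derivative (\<lambda>v. frechet_derivative g (at y) v \<bullet> c)) (at y)"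
    if "y \<in> X" for y c
    by (intro has_derivative_inner_left C1_on_has_derivative[OF C(1) that])
  have d2: "((\<lambda>y. frechet_derivative g (at y) v \<bullet> c) has_derivative (\<lambda>w. ?D v y w \<bullet> c)) (at y)"
    if "y \<in> X" for y v c
    by (intro has_derivative_inner_left C1_on_has_derivative[OF C(2) that])
  have "continuous_on X (\<lambda>y. ?D v y w \<bullet> c)" for v w c
    using C(2) by (intro continuous_intros) (auto simp: C1_on_def)
  then have "?D v x w \<bullet> c = ?D w x v \<bullet> c" for c
    by (intro symmetric_second_derivative_real[OF assms(2,3) d1 d2 d2])
  then show ?thesis using vector_eq_rdot by blast
qed

section \<open>Green's theorem on the unit disc\<close>

text \<open>Lebesgue measure is determined by its values on boxes, and a complex box is a rectangle.
  This gives access to Fubini in real and imaginary parts.\<close>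

lemma lborel_complex_distr:
  "distr (lborel \<Otimes>\<^sub>M lborel) borel (\<lambda>(x, y). Complex x y) = (lborel :: complex measure)"
proof (rule lborel_eqI[symmetric])
  have meas: "(\<lambda>(x, y). Complex x y) \<in> borel_measurable (lborel \<Otimes>\<^sub>M lborel)"
    unfolding lborel_prod split_beta measurable_lborel2
    by (intro borel_measurable_continuous_onI continuous_intros)
  fix l u :: complex
  assume le: "\<And>b. b \<in> Basis \<Longrightarrow> l \<bullet> b \<le> u \<bullet> b"
  have "Re l \<le> Re u" "Im l \<le> Im u"
    using le[of 1] le[of \<i>] by (auto simp: Basis_complex_def)
  have "(\<lambda>(x, y). Complex x y) -` box l u \<inter> space (lborel \<Otimes>\<^sub>M lborel) =
      {Re l<..<Re u} \<times> {Im l<..<Im u}"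
    by (auto simp: space_pair_measure box_def Basis_complex_def)
  then have "emeasure (distr (lborel \<Otimes>\<^sub>M lborel) borel (\<lambda>(x, y). Complex x y)) (box l u) =
      emeasure (lborel \<Otimes>\<^sub>M lborel) ({Re l<..<Re u} \<times> {Im l<..<Im u})"
    using meas by (simp add: emeasure_distr)
  also have "\<dots> = ennreal (Re u - Re l) * ennreal (Im u - Im l)"
    using \<open>Re l \<le> Re u\<close> \<open>Im l \<le> Im u\<close>
    by (subst lborel.emeasure_pair_measure_Times) auto
  also have "\<dots> = (\<Prod>b\<in>Basis. (u - l) \<bullet> b)"
    using \<open>Re l \<le> Re u\<close> \<open>Im l \<le> Im u\<close>
    by (simp add: Basis_complex_def prod_ennreal[symmetric] ennreal_mult)
  finally show "emeasure (distr (lborel \<Otimes>\<^sub>M lborel) borel (\<lambda>(x, y). Complex x y)) (box l u) =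
      (\<Prod>b\<in>Basis. (u - l) \<bullet> b)" .
qed simp

lemma integral_lborel_complex:
  fixes h :: "complex \<Rightarrow> 'a::{banach, second_countable_topology}"
  assumes "integrable lborel h"
  shows "integral\<^sup>L lborel h = (LINT y|lborel. LINT x|lborel. h (Complex x y))"
    and "integral\<^sup>L lborel h = (LINT x|lborel. LINT y|lborel. h (Complex x y))"
proof -
  have meas: "(\<lambda>(x, y). Complex x y) \<in> borel_measurable (lborel \<Otimes>\<^sub>M lborel)"
    unfolding lborel_prod split_beta measurable_lborel2
    by (intro borel_measurable_continuous_onI continuous_intros)
  have h: "h \<in> borel_measurable borel"
    using borel_measurable_integrable[OF assms] by simp
  have i: "integrable (lborel \<Otimes>\<^sub>M lborel) (\<lambda>(x, y). h (Complex x y))"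
    using integrable_distr_eq[OF meas h] assms by (simp add: lborel_complex_distr)
      (simp add: case_prod_unfold)
  have e: "integral\<^sup>L lborel h = integral\<^sup>L (lborel \<Otimes>\<^sub>M lborel) (\<lambda>(x, y). h (Complex x y))"
    using integral_distr[OF meas h] by (simp add: lborel_complex_distr)
      (simp add: case_prod_unfold)
  show "integral\<^sup>L lborel h = (LINT y|lborel. LINT x|lborel. h (Complex x y))"
    using lborel_pair.integral_snd[OF i] e by simp
  show "integral\<^sup>L lborel h = (LINT x|lborel. LINT y|lborel. h (Complex x y))"
    using lborel_pair.integral_fst[OF i] e by simp
qed

section \<open>Shifting and reflecting integrals of periodic functions\<close>

lemma integral_periodic:
  fixes f :: "real \<Rightarrow> 'a::euclidean_space"
  assumes cont: "continuous_on UNIV f" and per: "\<And>x. f (x + p) = f x"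
    and a: "- p \<le> a" "a \<le> 0"
  shows "integral {a..a + p} f = integral {0..p} f"
proof -
  have int: "f integrable_on {x..y}" for x y
    by (intro integrable_continuous_interval continuous_on_subset[OF cont]) auto
  have "integral {a..0} f + integral {0..a + p} f = integral {a..a + p} f"
    by (rule Henstock_Kurzweil_Integration.integral_combine) (use a int in auto)
  moreover have "integral {0..a + p} f + integral {a + p..p} f = integral {0..p} f"
    by (rule Henstock_Kurzweil_Integration.integral_combine) (use a int in auto)
  moreover have "integral {a..0} (f \<circ> (\<lambda>x. x + p)) = integral {a + p..0 + p} f"
    by (rule integral_shift) (intro continuous_on_subset[OF cont], auto)
  ultimately show ?thesis by (simp add: o_def per add.commute)
qed

lemma integral_periodic_reflect:
  fixes f :: "real \<Rightarrow> 'a::euclidean_space"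
  assumes cont: "continuous_on UNIV f" and per: "\<And>x. f (x + p) = f x" and "p \<ge> 0"
  shows "integral {0..p} (\<lambda>x. f (- x)) = integral {0..p} f"
proof -
  have "integral {0..p} (\<lambda>x. f (- x)) = integral {- p..0} f"
    using Henstock_Kurzweil_Integration.integral_reflect_real[of p 0 "\<lambda>x. f (- x)"] by simp
  also have "\<dots> = integral {0..p} f"
    using integral_periodic[OF cont per, of "-p"] assms(3) by simp
  finally show ?thesis .
qed

text \<open>The divergence theorem for a horizontal field, \<open>cos \<theta>\<close> being the
  first component of the outer normal. The fundamental theorem of calculus on each horizontal chord
  leaves the difference of its two end values, and \<open>y = sin \<theta>\<close> turns the
  integral over heights into one over arcs.\<close>

lemma disc_integral_horizontal_derivative:
  fixes f fx :: "complex \<Rightarrow> complex"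
  assumes cf: "continuous_on (cball 0 1) f" and cfx: "continuous_on (cball 0 1) fx"
    and der: "\<And>x y. Complex x y \<in> cball 0 1 \<Longrightarrow>
      ((\<lambda>x. f (Complex x y)) has_vector_derivative fx (Complex x y)) (at x)"
  shows "(LINT y|lborel. LINT x|lborel. indicator (cball 0 1) (Complex x y) *\<^sub>R fx (Complex x y)) =
    integral {0..2*pi} (\<lambda>\<theta>. cos \<theta> *\<^sub>R f (cis \<theta>))"
proof -
  \<comment> \<open>Half the length of the chord at height \<open>y\<close>, and the difference of
    \<open>f\<close> across that chord.\<close>
  define r where "r y = sqrt (1 - y\<^sup>2)" for y :: real
  define P where "P y = f (Complex (r y) y) - f (Complex (- r y) y)" for y
  have disc: "Complex x y \<in> cball 0 1 \<longleftrightarrow> y \<in> {-1..1} \<and> x \<in> {- r y..r y}" for x y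
  proof -
    have "Complex x y \<in> cball 0 1 \<longleftrightarrow> x\<^sup>2 + y\<^sup>2 \<le> 1"
      by (simp add: complex_norm)
    also have "\<dots> \<longleftrightarrow> y\<^sup>2 \<le> 1 \<and> x\<^sup>2 \<le> 1 - y\<^sup>2"
      using zero_le_power2[of x] by linarith
    also have "y\<^sup>2 \<le> 1 \<longleftrightarrow> y \<in> {-1..1}"
      by (auto simp: abs_square_le_1 abs_le_iff)
    also have "y \<in> {-1..1} \<and> x\<^sup>2 \<le> 1 - y\<^sup>2 \<longleftrightarrow> y \<in> {-1..1} \<and> \<bar>x\<bar> \<le> r y"
      unfolding r_def using real_sqrt_le_iff[of "x\<^sup>2" "1 - y\<^sup>2"] by simp
    finally show ?thesis by (auto simp: abs_le_iff)
  qed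
  have r0: "r y \<ge> 0" if "y \<in> {-1..1}" for y
    using that by (auto simp: r_def abs_square_le_1 abs_le_iff)
  have inner: "(LINT x|lborel. indicator (cball 0 1) (Complex x y) *\<^sub>R fx (Complex x y)) =
      indicator {-1..1} y *\<^sub>R P y" for y
  proof (cases "y \<in> {-1..1}")
    case True
    have eq: "indicator (cball 0 1) (Complex x y) = (indicator {- r y..r y} x :: real)" for x
      using disc[of x y] True by (auto simp: indicator_def)
    have "(LINT x|lborel. indicator {- r y..r y} x *\<^sub>R fx (Complex x y)) = P y"
      unfolding P_def
    proof (rule integral_FTC_Icc)
      show "- r y \<le> r y" using r0[OF True] by simp
      show "continuous_on {- r y..r y} (\<lambda>x. fx (Complex x y))"
        by (intro continuous_on_compose2[OF cfx] continuous_intros) (use disc True in blast)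
      fix x assume "- r y \<le> x" "x \<le> r y"
      then have "Complex x y \<in> cball 0 1" unfolding disc using True by simp
      then show "((\<lambda>x. f (Complex x y)) has_vector_derivative fx (Complex x y))
          (at x within {- r y..r y})"
        by (rule has_vector_derivative_at_within[OF der])
    qed
    then show ?thesis unfolding eq using True by simp
  next
    case False
    have "indicator (cball 0 1) (Complex x y) = (0 :: real)" for x
      using disc[of x y] False by (auto simp: indicator_def)
    then show ?thesis using False by simp
  qed
  have cP: "continuous_on {-1..1} P"
  proof -
    have "continuous_on {-1..1} r"
      unfolding r_def by (intro continuous_intros)
    then have "continuous_on {-1..1} (\<lambda>y. Complex (r y) y)"
      "continuous_on {-1..1} (\<lambda>y. Complex (- r y) y)"
      by (intro continuous_intros; assumption)+
    moreover have "(\<lambda>y. Complex (r y) y) ` {-1..1} \<subseteq> cball 0 1"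
      "(\<lambda>y. Complex (- r y) y) ` {-1..1} \<subseteq> cball 0 1"
      unfolding image_subset_iff disc using r0 by auto
    ultimately show ?thesis
      unfolding P_def by (intro continuous_on_diff continuous_on_compose2[OF cf])
  qed
  have cc: "continuous_on UNIV (\<lambda>\<theta>. cos \<theta> *\<^sub>R f (cis \<theta>))"
    by (intro continuous_intros continuous_on_compose2[OF cf]) auto
  have int: "(\<lambda>\<theta>. cos \<theta> *\<^sub>R f (cis \<theta>)) integrable_on {a..b}" for a b
    by (rule integrable_continuous_interval, rule continuous_on_subset[OF cc]) simp
  have int': "(\<lambda>\<theta>. cos (pi - \<theta>) *\<^sub>R f (cis (pi - \<theta>))) integrable_on {a..b}" for a b
    by (rule integrable_continuous_interval, rule continuous_on_compose2[OF cc])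
       (auto intro!: continuous_intros)
  have "(LINT y|lborel. indicator {-1..1} y *\<^sub>R P y) = integral {-1..1} P"
    using set_borel_integral_eq_integral(2)[OF borel_integrable_atLeastAtMost'[OF cP]]
    by (simp add: set_lebesgue_integral_def)
  also have "\<dots> = integral {-(pi/2)..pi/2} (\<lambda>\<theta>. cos \<theta> *\<^sub>R P (sin \<theta>))"
  proof -
    have "((\<lambda>\<theta>. cos \<theta> *\<^sub>R P (sin \<theta>)) has_integral integral {sin (-(pi/2))..sin (pi/2)} P)
        {-(pi/2)..pi/2}"
      by (rule has_integral_substitution[OF _ _ _ cP])
         (auto intro: has_field_derivative_at_within DERIV_sin)
    then show ?thesis by (simp add: has_integral_iff)
  qed
  also have "\<dots> = integral {-(pi/2)..pi/2} (\<lambda>\<theta>. cos \<theta> *\<^sub>R f (cis \<theta>) + cos (pi - \<theta>) *\<^sub>R f (cis (pi - \<theta>)))"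
  proof (rule Henstock_Kurzweil_Integration.integral_cong)
    fix \<theta> :: real assume "\<theta> \<in> {-(pi/2)..pi/2}"
    then have "cos \<theta> \<ge> 0" by (intro cos_ge_zero) auto
    moreover have "1 - (sin \<theta>)\<^sup>2 = (cos \<theta>)\<^sup>2"
      using sin_cos_squared_add2[of \<theta>] by linarith
    ultimately have r: "r (sin \<theta>) = cos \<theta>"
      by (simp only: r_def real_sqrt_abs abs_of_nonneg)
    have c: "cis (pi - \<theta>) = Complex (- cos \<theta>) (sin \<theta>)" "cis \<theta> = Complex (cos \<theta>) (sin \<theta>)"
      and "cos (pi - \<theta>) = - cos \<theta>"
      by (simp_all add: complex_eq_iff cos_diff sin_diff)
    then show "cos \<theta> *\<^sub>R P (sin \<theta>) = cos \<theta> *\<^sub>R f (cis \<theta>) + cos (pi - \<theta>) *\<^sub>R f (cis (pi - \<theta>))"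
      by (simp only: P_def r c) (simp add: scaleR_diff_right)
  qed
  also have "\<dots> = integral {-(pi/2)..pi/2} (\<lambda>\<theta>. cos \<theta> *\<^sub>R f (cis \<theta>)) +
      integral {-(pi/2)..pi/2} (\<lambda>\<theta>. cos (pi - \<theta>) *\<^sub>R f (cis (pi - \<theta>)))"
    by (intro Henstock_Kurzweil_Integration.integral_add int int')
  \<comment> \<open>The left half of the circle was parametrized by \<open>pi - \<theta>\<close>.
    Reflecting and shifting makes it the arc from \<open>pi/2\<close> to \<open>3*pi/2\<close>,
    which continues the right half to a full period.\<close>
  also have "integral {-(pi/2)..pi/2} (\<lambda>\<theta>. cos (pi - \<theta>) *\<^sub>R f (cis (pi - \<theta>))) =
      integral {-(pi/2)..pi/2} (\<lambda>\<theta>. cos (\<theta> + pi) *\<^sub>R f (cis (\<theta> + pi)))"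
    using Henstock_Kurzweil_Integration.integral_reflect_real[of "pi/2" "-(pi/2)"
        "\<lambda>\<theta>. cos (\<theta> + pi) *\<^sub>R f (cis (\<theta> + pi))"] by (simp add: add.commute)
  also have "\<dots> = integral {pi/2..3*pi/2} (\<lambda>\<theta>. cos \<theta> *\<^sub>R f (cis \<theta>))"
    using integral_shift[of "-(pi/2)" pi "pi/2" "\<lambda>\<theta>. cos \<theta> *\<^sub>R f (cis \<theta>)",
        OF continuous_on_subset[OF cc subset_UNIV]]
    by (simp add: o_def)
  also have "integral {-(pi/2)..pi/2} (\<lambda>\<theta>. cos \<theta> *\<^sub>R f (cis \<theta>)) + \<dots> =
      integral {-(pi/2)..3*pi/2} (\<lambda>\<theta>. cos \<theta> *\<^sub>R f (cis \<theta>))"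
    by (rule Henstock_Kurzweil_Integration.integral_combine) (auto intro: int)
  also have "\<dots> = integral {0..2*pi} (\<lambda>\<theta>. cos \<theta> *\<^sub>R f (cis \<theta>))"
    using integral_periodic[OF cc, of "2*pi" "-(pi/2)"]
    by (simp add: cis_mult[symmetric])
  finally show ?thesis by (simp add: inner)
qed

text \<open>The vertical case follows from the horizontal one by reflecting in the diagonal, which
  exchanges the coordinates and sends the angle \<open>\<theta>\<close> to
  \<open>pi/2 - \<theta>\<close>.\<close>

lemma disc_integral_partial_derivatives:
  fixes f :: "complex \<Rightarrow> complex" and f' :: "complex \<Rightarrow> complex \<Rightarrow> complex"
  assumes der: "\<And>z. z \<in> cball 0 1 \<Longrightarrow> (f has_derivative f' z) (at z)"
    and c1: "continuous_on (cball 0 1) (\<lambda>z. f' z 1)"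
    and c2: "continuous_on (cball 0 1) (\<lambda>z. f' z \<i>)"
  shows "set_lebesgue_integral lborel (cball 0 1) (\<lambda>z. f' z 1) =
      integral {0..2*pi} (\<lambda>\<theta>. cos \<theta> *\<^sub>R f (cis \<theta>))"
    and "set_lebesgue_integral lborel (cball 0 1) (\<lambda>z. f' z \<i>) =
      integral {0..2*pi} (\<lambda>\<theta>. sin \<theta> *\<^sub>R f (cis \<theta>))"
proof -
  have cf: "continuous_on (cball 0 1) f"
    by (rule has_derivative_continuous_on, rule has_derivative_at_withinI) (use der in auto)
  have dx: "((\<lambda>x. f (Complex x y)) has_vector_derivative f' (Complex x y) 1) (at x)"
    and dy: "((\<lambda>y. f (Complex x y)) has_vector_derivative f' (Complex x y) \<i>) (at y)"
    if "Complex x y \<in> cball 0 1" for x y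
  proof -
    have lin: "f' (Complex x y) (t *\<^sub>R v) = t *\<^sub>R f' (Complex x y) v" for t v
      using has_derivative_linear[OF der[OF that]] by (simp add: linear_cmul)
    have 1: "((\<lambda>x. Complex x y) has_derivative (\<lambda>t. t *\<^sub>R 1)) (at x)"
      "((\<lambda>y. Complex x y) has_derivative (\<lambda>t. t *\<^sub>R \<i>)) (at y)"
      unfolding Complex_eq by (auto intro!: derivative_eq_intros simp: fun_eq_iff scaleR_conv_of_real)
    show "((\<lambda>x. f (Complex x y)) has_vector_derivative f' (Complex x y) 1) (at x)"
      using has_derivative_compose[OF 1(1), of f, OF der[OF that]]
      by (simp add: has_vector_derivative_def lin)
    show "((\<lambda>y. f (Complex x y)) has_vector_derivative f' (Complex x y) \<i>) (at y)"
      using has_derivative_compose[OF 1(2), of f, OF der[OF that]]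
      by (simp add: has_vector_derivative_def lin)
  qed
  have int: "integrable lborel (\<lambda>z. indicator (cball 0 1) z *\<^sub>R f' z v)" if "v = 1 \<or> v = \<i>" for v
    by (rule borel_integrable_compact) (use c1 c2 that in auto)
  show "set_lebesgue_integral lborel (cball 0 1) (\<lambda>z. f' z 1) =
      integral {0..2*pi} (\<lambda>\<theta>. cos \<theta> *\<^sub>R f (cis \<theta>))"
    unfolding set_lebesgue_integral_def
    using integral_lborel_complex(1)[OF int, of 1] disc_integral_horizontal_derivative[OF cf c1 dx]
    by simp
  let ?T = "\<lambda>z. \<i> * cnj z" and ?G = "\<lambda>\<theta>. sin \<theta> *\<^sub>R f (cis \<theta>)"
  have contG: "continuous_on UNIV ?G"
    by (intro continuous_intros continuous_on_compose2[OF cf]) auto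
  have cG: "?G (\<theta> + 2*pi) = ?G \<theta>" for \<theta>
    by (simp add: cis_mult[symmetric])
  have T: "?T (Complex x y) = Complex y x" for x y by (simp add: complex_eq_iff)
  have ind: "indicator (cball 0 1) (Complex y x) = (indicator (cball 0 1) (Complex x y) :: real)" for x y
    by (simp add: indicator_def complex_norm add.commute)
  have "set_lebesgue_integral lborel (cball 0 1) (\<lambda>z. f' z \<i>) =
      (LINT y|lborel. LINT x|lborel. indicator (cball 0 1) (Complex x y) *\<^sub>R f' (?T (Complex x y)) \<i>)"
    unfolding set_lebesgue_integral_def
    using integral_lborel_complex(2)[OF int, of \<i>] by (simp add: T ind)
  also have "\<dots> = integral {0..2*pi} (\<lambda>\<theta>. cos \<theta> *\<^sub>R f (?T (cis \<theta>)))"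
  proof (rule disc_integral_horizontal_derivative)
    show "continuous_on (cball 0 1) (\<lambda>z. f (?T z))"
      by (intro continuous_on_compose2[OF cf] continuous_intros) (auto simp: norm_mult)
    show "continuous_on (cball 0 1) (\<lambda>z. f' (?T z) \<i>)"
      by (intro continuous_on_compose2[OF c2] continuous_intros) (auto simp: norm_mult)
    fix x y assume "Complex x y \<in> cball 0 1"
    then have "Complex y x \<in> cball 0 1" by (simp add: complex_norm add.commute)
    from dy[OF this]
    show "((\<lambda>x. f (?T (Complex x y))) has_vector_derivative f' (?T (Complex x y)) \<i>) (at x)"
      by (simp only: T)
  qed
  \<comment> \<open>The angle \<open>pi/2 - \<theta>\<close> is lowered by a full turn, so that the
    shift \<open>- (3*pi/2)\<close> lies between minus one period and 0, as
    \<open>integral_periodic\<close> requires.\<close>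
  also have "\<dots> = integral {0..2*pi} (\<lambda>\<theta>. ?G (- \<theta> + - (3*pi/2)))"
  proof (rule Henstock_Kurzweil_Integration.integral_cong)
    fix \<theta> :: real
    have "cis (- \<theta> + - (3*pi/2)) = cis (pi/2 - \<theta>)"
    proof -
      have "- \<theta> + - (3*pi/2) = (pi/2 - \<theta>) - 2*pi" by simp
      then show ?thesis by (simp only: cis_divide[symmetric] cis_2pi div_by_1)
    qed
    moreover from arg_cong[OF this, of Im] have "sin (- \<theta> + - (3*pi/2)) = cos \<theta>"
      by (simp add: cos_sin_eq)
    moreover have "cis (pi/2 - \<theta>) = ?T (cis \<theta>)"
      by (simp add: complex_eq_iff sin_diff cos_diff)
    ultimately show "cos \<theta> *\<^sub>R f (?T (cis \<theta>)) = ?G (- \<theta> + - (3*pi/2))"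
      by (simp only:)
  qed
  also have "\<dots> = integral {0..2*pi} (\<lambda>\<theta>. ?G (\<theta> + - (3*pi/2)))"
  proof (rule integral_periodic_reflect[where f = "\<lambda>\<theta>. ?G (\<theta> + - (3*pi/2))"])
    show "continuous_on UNIV (\<lambda>\<theta>. ?G (\<theta> + - (3*pi/2)))"
      by (intro continuous_intros continuous_on_compose2[OF cf]) auto
    fix \<theta>
    show "?G (\<theta> + 2*pi + - (3*pi/2)) = ?G (\<theta> + - (3*pi/2))"
      using cG[of "\<theta> + - (3*pi/2)"] by (simp only: add.assoc add.commute add.left_commute)
  qed simp
  also have "\<dots> = integral {- (3*pi/2)..- (3*pi/2) + 2*pi} ?G"
    using integral_shift[of 0 "- (3*pi/2)" "2*pi" ?G, OF continuous_on_subset[OF contG subset_UNIV]]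
    by (simp add: o_def)
  also have "\<dots> = integral {0..2*pi} ?G"
    by (rule integral_periodic[OF contG cG]) auto
  finally show "set_lebesgue_integral lborel (cball 0 1) (\<lambda>z. f' z \<i>) =
      integral {0..2*pi} (\<lambda>\<theta>. sin \<theta> *\<^sub>R f (cis \<theta>))" .
qed

section \<open>Functions holomorphic outside the unit disc\<close>

text \<open>Cauchy's formula on the unit circle itself, where \<open>h\<close> is only continuous;
  the factor \<open>\<i> * cis \<theta>\<close> from the parametrization cancels one power and the
  \<open>\<i>\<close> of \<open>2 * pi * \<i>\<close>. The angle is reversed so that, for
  \<open>h = at_inverse f\<close>, the formula reads off the coefficient of \<open>1 / z ^ k\<close>
  in \<open>f\<close>.\<close>

lemma disc_fourier_coefficient:
  fixes h :: "complex \<Rightarrow> complex"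
  assumes "continuous_on (cball 0 1) h" "h holomorphic_on ball 0 1"
  shows "integral {0..2*pi} (\<lambda>\<theta>. h (cis (- \<theta>)) * cis \<theta> ^ k) = 2 * pi * (deriv ^^ k) h 0 / fact k"
proof -
  have "((\<lambda>u. h u / (u - 0) ^ Suc k) has_contour_integral
      (2 * pi * \<i>) / fact k * (deriv ^^ k) h 0) (circlepath 0 1)"
    by (rule Cauchy_has_contour_integral_higher_derivative_circlepath[OF assms]) simp
  then have "((\<lambda>\<theta>. h (cis \<theta>) / cis \<theta> ^ Suc k * \<i> * cis \<theta>) has_integral
      (2 * pi * \<i>) / fact k * (deriv ^^ k) h 0) {0..2*pi}"
    unfolding circlepath_def by (subst (asm) has_contour_integral_part_circlepath_iff) auto
  then have "((\<lambda>\<theta>. \<i> * (h (cis \<theta>) / cis \<theta> ^ k)) has_integral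
      (2 * pi * \<i>) / fact k * (deriv ^^ k) h 0) {0..2*pi}"
    by (rule has_integral_eq[rotated]) (simp add: field_simps)
  from has_integral_mult_right[OF this, of "- \<i>"]
  have "((\<lambda>\<theta>. h (cis \<theta>) / cis \<theta> ^ k) has_integral 2 * pi * (deriv ^^ k) h 0 / fact k) {0..2*pi}"
    by (simp add: field_simps)
  then have "integral {0..2*pi} (\<lambda>\<theta>. h (cis \<theta>) / cis \<theta> ^ k) = 2 * pi * (deriv ^^ k) h 0 / fact k"
    by (rule integral_unique)
  moreover have "integral {0..2*pi} (\<lambda>\<theta>. h (cis (- \<theta>)) / cis (- \<theta>) ^ k) =
      integral {0..2*pi} (\<lambda>\<theta>. h (cis \<theta>) / cis \<theta> ^ k)"
  proof (rule integral_periodic_reflect[where f = "\<lambda>\<theta>. h (cis \<theta>) / cis \<theta> ^ k"])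
    show "continuous_on UNIV (\<lambda>\<theta>. h (cis \<theta>) / cis \<theta> ^ k)"
      by (intro continuous_intros continuous_on_compose2[OF assms(1)]) auto
  qed (simp_all add: cis_mult[symmetric])
  moreover have "h (cis (- \<theta>)) / cis (- \<theta>) ^ k = h (cis (- \<theta>)) * cis \<theta> ^ k" for \<theta>
    by (simp add: cis_inverse[symmetric] power_inverse field_simps)
  ultimately show ?thesis by simp
qed

text \<open>The value at \<open>0\<close> stands for the limit \<open>0\<close> of \<open>f\<close> at infinity.\<close>

definition at_inverse :: "(complex \<Rightarrow> complex) \<Rightarrow> complex \<Rightarrow> complex" where
  "at_inverse f z = (if z = 0 then 0 else f (1 / z))"

lemma at_inverse_cis: "at_inverse f (cis (- \<theta>)) = f (cis \<theta>)"
  by (simp add: at_inverse_def cis_inverse[symmetric] field_simps)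

text \<open>The expansion at infinity becomes a power series around 0, and away from 0 the inversion
  is holomorphic. The two open pieces cover the disc.\<close>

lemma at_inverse_holomorphic:
  assumes hol: "f holomorphic_on (- cball 0 1)"
    and ser: "\<forall>\<^sub>F z in at_infinity. (\<lambda>i. c i / z ^ Suc i) sums f z"
  shows "at_inverse f holomorphic_on ball 0 1"
proof -
  obtain b where b: "\<And>z. b \<le> norm z \<Longrightarrow> (\<lambda>i. c i / z ^ Suc i) sums f z"
    using ser by (auto simp: eventually_at_infinity)
  \<comment> \<open>The maximum keeps the radius positive even when \<open>b\<close> is not.\<close>
  define r where "r = 1 / max b 1"
  have "r > 0" by (simp add: r_def)
  have "at_inverse f holomorphic_on ball 0 r"
  proof (rule power_series_holomorphic)
    fix z :: complex assume z: "z \<in> ball 0 r"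
    \<comment> \<open>The expansion starts with \<open>1 / z\<close>, hence the shift by one and the
      vanishing constant term.\<close>
    define a where "a n = (case n of 0 \<Rightarrow> 0 | Suc i \<Rightarrow> c i)" for n
    have "(\<lambda>n. a n * z ^ n) sums at_inverse f z"
    proof (cases "z = 0")
      case True
      then show ?thesis using powser_sums_zero[of a] by (simp add: at_inverse_def a_def)
    next
      case False
      have "1 / r < 1 / norm z"
        using z False \<open>r > 0\<close> by (intro divide_strict_left_mono) auto
      then have "max b 1 < norm (1 / z)"
        by (simp add: r_def norm_divide)
      then have "(\<lambda>i. c i / (1 / z) ^ Suc i) sums f (1 / z)"
        by (intro b) simp
      then have "(\<lambda>i. a (Suc i) * z ^ Suc i) sums f (1 / z)"
        using False by (simp add: a_def field_simps)
      then have "(\<lambda>n. a n * z ^ n) sums (f (1 / z) + a 0 * z ^ 0)"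
        using sums_Suc_iff[of "\<lambda>n. a n * z ^ n"] by blast
      then show ?thesis using False by (simp add: at_inverse_def a_def)
    qed
    then show "(\<lambda>n. a n * (z - 0) ^ n) sums at_inverse f z" by simp
  qed
  moreover have "at_inverse f holomorphic_on ball 0 1 - {0}"
  proof (rule holomorphic_transform)
    show "(f \<circ> (\<lambda>z. 1 / z)) holomorphic_on ball 0 1 - {0}"
      by (rule holomorphic_on_compose_gen[OF _ hol])
         (auto intro!: holomorphic_intros simp: norm_divide field_simps)
  qed (simp add: at_inverse_def)
  ultimately have "at_inverse f holomorphic_on (ball 0 r \<union> (ball 0 1 - {0}))"
    by (intro holomorphic_on_Un) (auto intro: open_Diff)
  then show ?thesis
    by (rule holomorphic_on_subset) (use \<open>r > 0\<close> in auto)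
qed

lemma at_inverse_continuous:
  assumes "continuous_on UNIV f" "at_inverse f holomorphic_on ball 0 1"
  shows "continuous_on (cball 0 1) (at_inverse f)"
proof -
  have "continuous_on (- {0}) (\<lambda>z. f (1 / z))"
    by (intro continuous_on_compose2[OF assms(1)] continuous_intros) auto
  then have "continuous_on (- {0}) (at_inverse f)"
    by (simp add: at_inverse_def cong: continuous_on_cong_simp)
  moreover have "continuous_on (ball 0 1) (at_inverse f)"
    by (rule holomorphic_on_imp_continuous_on[OF assms(2)])
  ultimately have "continuous_on (- {0} \<union> ball 0 1) (at_inverse f)"
    by (intro continuous_on_open_Un) (auto intro: open_Compl)
  then show ?thesis
    by (rule continuous_on_subset) auto
qed

text \<open>In the inverted variable both functions extend holomorphically into the disc.
  Integration by parts moves the derivative from \<open>v\<close> to \<open>w\<close> and leaves the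
  mean over the circle of a holomorphic function that vanishes at 0.\<close>

lemma at_inverse_boundary_orthogonality:
  fixes v w :: "complex \<Rightarrow> complex" and dv :: "real \<Rightarrow> complex"
  assumes v: "continuous_on UNIV v" "at_inverse v holomorphic_on ball 0 1"
    and w: "continuous_on UNIV w" "at_inverse w holomorphic_on ball 0 1"
    and dv: "\<And>\<theta>. ((\<lambda>\<theta>. v (cis \<theta>)) has_vector_derivative dv \<theta>) (at \<theta>)" "continuous_on UNIV dv"
  shows "integral {0..2*pi} (\<lambda>\<theta>. w (cis \<theta>) * dv \<theta>) = 0"
proof -
  let ?v = "at_inverse v" and ?w = "at_inverse w"
  note cv = at_inverse_continuous[OF v] and cw = at_inverse_continuous[OF w]
  have hw: "deriv ?w holomorphic_on ball 0 1"
    by (rule holomorphic_deriv[OF w(2)]) simp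
  \<comment> \<open>\<open>w\<close> need not be differentiable on the circle, so integrate by parts with \<open>w\<close> replaced by its
    values on a slightly larger circle, of radius \<open>1/\<rho>\<close>.\<close>
  define J where "J \<rho> = integral {0..2*pi} (\<lambda>\<theta>. dv \<theta> * ?w (of_real \<rho> * cis (- \<theta>)))" for \<rho>
  have J0: "J \<rho> = 0" if \<rho>: "0 < \<rho>" "\<rho> < 1" for \<rho>
  proof -
    \<comment> \<open>The angular derivative of \<open>w\<close> on the larger circle;
      \<open>\<phi>\<close> below is its product with \<open>v\<close>, written in the inverted
      variable \<open>z = cis (- \<theta>)\<close>.\<close>
    define g' where "g' \<theta> = - \<i> * of_real \<rho> * cis (- \<theta>) * deriv ?w (of_real \<rho> * cis (- \<theta>))" for \<theta>
    define \<phi> where "\<phi> z = ?v z * (- \<i> * of_real \<rho> * z * deriv ?w (of_real \<rho> * z))" for z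
    have sub: "(\<lambda>z. of_real \<rho> * z) ` cball 0 1 \<subseteq> ball (0::complex) 1"
    proof -
      have "\<rho> * norm z < 1" if "norm z \<le> 1" for z :: complex
        using mult_left_mono[OF that, of \<rho>] \<rho> by linarith
      then show ?thesis using \<rho> by (auto simp: norm_mult)
    qed
    then have sub': "(\<lambda>z. of_real \<rho> * z) ` ball 0 1 \<subseteq> ball (0::complex) 1"
      by (meson ball_subset_cball image_mono subset_trans)
    have "continuous_on (cball 0 1) (\<lambda>z. deriv ?w (of_real \<rho> * z))"
      by (rule continuous_on_compose2[OF holomorphic_on_imp_continuous_on[OF hw] _ sub])
         (intro continuous_intros)
    then have "continuous_on (cball 0 1) \<phi>"
      unfolding \<phi>_def by (intro continuous_intros cv)
    moreover have "(deriv ?w \<circ> (\<lambda>z. of_real \<rho> * z)) holomorphic_on ball 0 1"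
      by (rule holomorphic_on_compose_gen[OF _ hw sub']) (intro holomorphic_intros)
    then have "\<phi> holomorphic_on ball 0 1"
      unfolding \<phi>_def o_def by (intro holomorphic_intros v(2))
    \<comment> \<open>The zeroth Fourier coefficient is \<open>2 * pi\<close> times
      \<open>\<phi> 0\<close>, and the factor \<open>z\<close> in \<open>\<phi>\<close> makes that
      0.\<close>
    ultimately have "integral {0..2*pi} (\<lambda>\<theta>. \<phi> (cis (- \<theta>)) * cis \<theta> ^ 0) = 0"
      by (subst disc_fourier_coefficient) (auto simp: \<phi>_def)
    moreover have "(\<lambda>\<theta>. \<phi> (cis (- \<theta>))) integrable_on {0..2*pi}"
      by (intro integrable_continuous_interval continuous_on_compose2[OF \<open>continuous_on (cball 0 1) \<phi>\<close>]
          continuous_intros) auto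
    ultimately have "((\<lambda>\<theta>. \<phi> (cis (- \<theta>))) has_integral 0) {0..2*pi}"
      by (simp add: has_integral_iff)
    \<comment> \<open>Zero again, since the boundary terms cancel over a full turn; they are spelled
      out in the shape that integration by parts expects.\<close>
    have i: "((\<lambda>\<theta>. v (cis \<theta>) * g' \<theta>) has_integral
        v (cis (2*pi)) * ?w (of_real \<rho> * cis (- (2*pi))) - v (cis 0) * ?w (of_real \<rho> * cis (- 0)) - 0)
        {0..2*pi}"
    proof -
      have "\<phi> (cis (- \<theta>)) = v (cis \<theta>) * g' \<theta>" for \<theta>
        by (simp only: \<phi>_def g'_def at_inverse_cis)
      moreover have "cis (- (2*pi)) = 1" by (simp add: complex_eq_iff)
      ultimately show ?thesis
        using \<open>((\<lambda>\<theta>. \<phi> (cis (- \<theta>))) has_integral 0) {0..2*pi}\<close> by simp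
    qed
    have dg: "((\<lambda>\<theta>. ?w (of_real \<rho> * cis (- \<theta>))) has_vector_derivative g' \<theta>) (at \<theta>)" for \<theta>
    proof -
      have "((\<lambda>\<theta>. of_real \<rho> * cis (- \<theta>)) has_vector_derivative (- \<i> * of_real \<rho> * cis (- \<theta>))) (at \<theta>)"
      proof -
        have "((\<lambda>z. of_real \<rho> * exp (- \<i> * z)) has_field_derivative
            - \<i> * of_real \<rho> * exp (- \<i> * of_real \<theta>)) (at (of_real \<theta>))"
          by (auto intro!: derivative_eq_intros)
        from has_vector_derivative_real_field[OF this]
        show ?thesis by (simp add: cis_conv_exp)
      qed
      moreover have "(?w has_field_derivative deriv ?w (of_real \<rho> * cis (- \<theta>))) (at (of_real \<rho> * cis (- \<theta>)))"
        by (rule holomorphic_derivI[OF w(2)]) (use \<rho> in \<open>auto simp: norm_mult\<close>)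
      ultimately show ?thesis
        unfolding g'_def by (rule field_vector_diff_chain_at[unfolded o_def])
    qed
    have "((\<lambda>\<theta>. dv \<theta> * ?w (of_real \<rho> * cis (- \<theta>))) has_integral 0) {0..2*pi}"
    proof (rule integration_by_parts[OF bounded_bilinear_mult, where f' = dv])
      show "continuous_on {0..2*pi} (\<lambda>\<theta>. v (cis \<theta>))"
        by (intro continuous_on_compose2[OF v(1)] continuous_intros) auto
      show "continuous_on {0..2*pi} (\<lambda>\<theta>. ?w (of_real \<rho> * cis (- \<theta>)))"
        using dg by (intro continuous_at_imp_continuous_on) (blast intro: has_vector_derivative_continuous)
      show "((\<lambda>\<theta>. v (cis \<theta>) * g' \<theta>) has_integral
        v (cis (2*pi)) * ?w (of_real \<rho> * cis (- (2*pi))) - v (cis 0) * ?w (of_real \<rho> * cis (- 0)) - 0)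
        {0..2*pi}" by (rule i)
    qed (use dv dg in auto)
    then show ?thesis by (simp add: J_def integral_unique)
  qed
  \<comment> \<open>Continuity of \<open>at_inverse w\<close> up to the circle lets the radius tend
    to 1.\<close>
  have "continuous_on ({0..1} \<times> cbox 0 (2*pi)) (\<lambda>(\<rho>, \<theta>). dv \<theta> * ?w (of_real \<rho> * cis (- \<theta>)))"
    unfolding split_beta
    by (intro continuous_intros continuous_on_compose2[OF cw] continuous_on_compose2[OF dv(2)])
       (auto simp: norm_mult)
  from integral_continuous_on_param[OF this] have "continuous_on {0..1} J"
    unfolding J_def by simp
  then have "continuous_on (closure {0<..<1}) J" by simp
  from continuous_constant_on_closure[OF this, of 0 1] J0 have "J 1 = 0" by auto
  then show ?thesis by (simp add: J_def at_inverse_cis mult.commute)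
qed

section \<open>Holomorphic families on the disc\<close>

text \<open>Dominated convergence for difference quotients along sequences. A ball is convex, so the
  mean value inequality turns the bound on \<open>h'\<close> into the same bound on the
  quotients.\<close>

lemma has_field_derivative_lebesgue_integral:
  fixes h h' :: "complex \<Rightarrow> 'a \<Rightarrow> complex"
  assumes \<rho>: "\<rho> > 0"
    and int: "\<And>s. s \<in> ball s0 \<rho> \<Longrightarrow> integrable M (h s)"
    and der: "\<And>s x. s \<in> ball s0 \<rho> \<Longrightarrow> x \<in> space M \<Longrightarrow>
      ((\<lambda>s. h s x) has_field_derivative h' s x) (at s)"
    and bound: "\<And>s x. s \<in> ball s0 \<rho> \<Longrightarrow> x \<in> space M \<Longrightarrow> norm (h' s x) \<le> m x"
    and m: "integrable M m"
  shows "((\<lambda>s. integral\<^sup>L M (h s)) has_field_derivative integral\<^sup>L M (h' s0)) (at s0)"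
proof -
  let ?q = "\<lambda>s x. (h s x - h s0 x) / (s - s0)"
  have s0: "s0 \<in> ball s0 \<rho>" using \<rho> by simp
  have "((\<lambda>s. (integral\<^sup>L M (h s) - integral\<^sup>L M (h s0)) / (s - s0)) \<longlongrightarrow> integral\<^sup>L M (h' s0))
      (at s0 within ball s0 \<rho>)"
    unfolding tendsto_at_iff_sequentially
  proof (intro allI impI)
    fix X assume X: "\<forall>i. X i \<in> ball s0 \<rho> - {s0}" "X \<longlonglongrightarrow> s0"
    have q: "integrable M (?q (X i))" for i
      using X(1) int[of "X i"] int[OF s0] by (intro integrable_divide integrable_diff) auto
    have lim: "(\<lambda>i. ?q (X i) x) \<longlonglongrightarrow> h' s0 x" if "x \<in> space M" for x
    proof -
      have "((\<lambda>s. ?q s x) \<longlongrightarrow> h' s0 x) (at s0)"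
        using der[OF s0 that] by (simp add: has_field_derivative_iff)
      moreover have "filterlim X (at s0) sequentially"
        using X by (auto simp: filterlim_at)
      ultimately show ?thesis by (rule filterlim_compose)
    qed
    have "(\<lambda>i. integral\<^sup>L M (?q (X i))) \<longlonglongrightarrow> integral\<^sup>L M (h' s0)"
    proof (rule integral_dominated_convergence[where w = m])
      show "?q (X i) \<in> borel_measurable M" for i
        by (rule borel_measurable_integrable[OF q])
      show "h' s0 \<in> borel_measurable M"
        by (rule borel_measurable_LIMSEQ_metric[OF borel_measurable_integrable[OF q] lim])
      show "AE x in M. norm (?q (X i) x) \<le> m x" for i
      proof (rule AE_I2)
        fix x assume x: "x \<in> space M"
        have "norm (h (X i) x - h s0 x) \<le> m x * norm (X i - s0)"
          by (rule field_differentiable_bound[where S = "ball s0 \<rho>" and f' = "\<lambda>s. h' s x"])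
             (use X(1) s0 x der bound in \<open>auto intro: has_field_derivative_at_within\<close>)
        then show "norm (?q (X i) x) \<le> m x"
          using X(1) by (simp add: norm_divide divide_le_eq)
      qed
    qed (use m lim in auto)
    moreover have "integral\<^sup>L M (?q (X i)) = (integral\<^sup>L M (h (X i)) - integral\<^sup>L M (h s0)) / (X i - s0)" for i
    proof -
      have "integral\<^sup>L M (\<lambda>x. h (X i) x - h s0 x) = integral\<^sup>L M (h (X i)) - integral\<^sup>L M (h s0)"
        using X(1) by (intro Bochner_Integration.integral_diff int[OF s0] int) auto
      then show ?thesis by simp
    qed
    ultimately show "((\<lambda>s. (integral\<^sup>L M (h s) - integral\<^sup>L M (h s0)) / (s - s0)) \<circ> X)
        \<longlonglongrightarrow> integral\<^sup>L M (h' s0)"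
      by (simp only: o_def)
  qed
  then show ?thesis
    using at_within_open[OF s0 open_ball] by (simp add: has_field_derivative_iff)
qed

section \<open>Smooth functions of a disc variable and a parameter\<close>

lemma has_derivative_slice_fst:
  assumes "(f has_derivative f') (at (z, s))"
  shows "((\<lambda>z. f (z, s)) has_derivative (\<lambda>h. f' (h, 0))) (at z)"
proof -
  have "((\<lambda>z. (z, s)) has_derivative (\<lambda>h. (h, 0))) (at z)"
    by (auto intro!: derivative_eq_intros)
  from has_derivative_compose[OF this assms] show ?thesis .
qed

lemma has_derivative_slice_snd:
  assumes "(f has_derivative f') (at (z, s))"
  shows "((\<lambda>s. f (z, s)) has_derivative (\<lambda>h. f' (0, h))) (at s)"
proof -
  have "((\<lambda>s. (z, s)) has_derivative (\<lambda>h. (0, h))) (at s)"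
    by (auto intro!: derivative_eq_intros)
  from has_derivative_compose[OF this assms] show ?thesis .
qed

lemma set_integrable_lborel_continuous:
  fixes f :: "'a::euclidean_space \<Rightarrow> 'b::{banach, second_countable_topology}"
  assumes "compact A" "continuous_on A f"
  shows "set_integrable lborel A f"
  using borel_integrable_compact[OF assms] by (simp add: set_integrable_def)

text \<open>\<open>g\<close> will be a smooth extension of \<open>St (t(n := s)) z\<close> beyond
  the closed disc, so that boundary points have genuine two-sided derivatives. Off the disc the
  extension is arbitrary, hence holomorphy in \<open>s\<close> is asked only over the disc.\<close>

locale holomorphic_disc_family =
  fixes X :: "(complex \<times> complex) set" and g :: "complex \<times> complex \<Rightarrow> complex"
    and \<Sigma> :: "complex set"
  assumes open_X: "open X" and open_\<Sigma>: "open \<Sigma>"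
    and disc_subset: "cball 0 1 \<times> \<Sigma> \<subseteq> X"
    and C2: "C2_on g X"
    and holomorphic: "\<And>z. z \<in> cball 0 1 \<Longrightarrow> (\<lambda>s. g (z, s)) holomorphic_on \<Sigma>"
begin

definition D :: "complex \<times> complex \<Rightarrow> complex \<times> complex \<Rightarrow> complex" where
  "D v p = frechet_derivative g (at p) v"

definition DD :: "complex \<times> complex \<Rightarrow> complex \<times> complex \<Rightarrow> complex \<times> complex \<Rightarrow> complex" where
  "DD v w p = frechet_derivative (D v) (at p) w"

definition g_dz where "g_dz p = (D (1, 0) p - \<i> * D (\<i>, 0) p) / 2"
definition g_dbar where "g_dbar p = (D (1, 0) p + \<i> * D (\<i>, 0) p) / 2"
text \<open>\<open>D (0, 1)\<close> differentiates in the real direction of the parameter, which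
  over the disc is the complex derivative \<open>u\<close> by holomorphy. These are the Wirtinger
  derivatives of \<open>u\<close> in the disc variable.\<close>

definition gs_dz where "gs_dz p = (DD (0, 1) (1, 0) p - \<i> * DD (0, 1) (\<i>, 0) p) / 2"
definition gs_dbar where "gs_dbar p = (DD (0, 1) (1, 0) p + \<i> * DD (0, 1) (\<i>, 0) p) / 2"

lemma g_derivative: "p \<in> X \<Longrightarrow> (g has_derivative (\<lambda>v. D v p)) (at p)"
  using C2 C1_on_has_derivative[of g X p] by (simp add: C2_on_def D_def)

lemma C1_D: "C1_on (D v) X"
  using C2 unfolding C2_on_def D_def[abs_def] by blast

lemma D_derivative: "p \<in> X \<Longrightarrow> (D v has_derivative (\<lambda>w. DD v w p)) (at p)"
  using C1_on_has_derivative[OF C1_D] by (simp add: DD_def)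

lemma DD_commute: "p \<in> X \<Longrightarrow> DD v w p = DD w v p"
  using C2_on_symmetric[OF C2 open_X] by (simp add: DD_def D_def[abs_def])

lemma continuous_g: "continuous_on X g"
  by (rule has_derivative_continuous_on, rule has_derivative_at_withinI, rule g_derivative)

lemma continuous_D: "continuous_on X (D v)"
  using C2 unfolding C2_on_def C1_on_def D_def[abs_def] by blast

lemma continuous_DD: "continuous_on X (DD v w)"
  using C1_D unfolding C1_on_def DD_def[abs_def] by blast

lemma continuous_on_disc_slice:
  assumes "continuous_on X f" "s \<in> \<Sigma>"
  shows "continuous_on (cball 0 1) (\<lambda>z. f (z, s))"
  by (rule continuous_on_compose2[OF assms(1)])
     (use disc_subset assms(2) in \<open>auto intro!: continuous_intros\<close>)

lemma continuous_dz_dbar: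
  "continuous_on X g_dz" "continuous_on X g_dbar" "continuous_on X gs_dz" "continuous_on X gs_dbar"
  unfolding g_dz_def[abs_def] g_dbar_def[abs_def] gs_dz_def[abs_def] gs_dbar_def[abs_def]
  by (intro continuous_intros continuous_D continuous_DD; simp)+

lemma g_field_derivative:
  assumes "z \<in> cball 0 1" "s \<in> \<Sigma>"
  shows "((\<lambda>s. g (z, s)) has_field_derivative D (0, 1) (z, s)) (at s)"
    and "D (0, h) (z, s) = h * D (0, 1) (z, s)"
proof -
  have X: "(z, s) \<in> X" using assms disc_subset by auto
  obtain d where d: "((\<lambda>s. g (z, s)) has_field_derivative d) (at s)"
    using holomorphic[OF assms(1)] assms(2) open_\<Sigma>
    by (metis holomorphic_on_open)
  have eq: "D (0, h) (z, s) = d * h" for h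
    using has_derivative_unique[OF has_derivative_slice_snd[OF g_derivative[OF X]]
        d[unfolded has_field_derivative_def]]
    by (simp add: fun_eq_iff)
  show "((\<lambda>s. g (z, s)) has_field_derivative D (0, 1) (z, s)) (at s)"
    using d by (simp add: eq)
  show "D (0, h) (z, s) = h * D (0, 1) (z, s)"
    by (simp add: eq)
qed

text \<open>Holomorphy in the parameter is inherited by the derivatives in the disc variable, because
  mixed second derivatives commute.\<close>

lemma D_field_derivative:
  assumes "z \<in> ball 0 1" "s \<in> \<Sigma>"
  shows "((\<lambda>s. D (v, 0) (z, s)) has_field_derivative DD (0, 1) (v, 0) (z, s)) (at s)"
proof -
  have X: "(z, s) \<in> X" using assms disc_subset by auto
  have lin: "DD (0, h) w (z, s) = h * DD (0, 1) w (z, s)" for h w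
  proof -
    have 1: "((\<lambda>p. h * D (0, 1) p) has_derivative (\<lambda>w. h * DD (0, 1) w (z, s))) (at (z, s))"
      by (rule has_derivative_mult_right[OF D_derivative[OF X]])
    \<comment> \<open>Complex linearity in the parameter holds only over the disc, so it can be
      differentiated only at interior points.\<close>
    have "(D (0, h) has_derivative (\<lambda>w. h * DD (0, 1) w (z, s))) (at (z, s))"
    proof (rule has_derivative_transform_within_open[OF 1])
      show "open (ball 0 1 \<times> \<Sigma>)" by (intro open_Times open_ball open_\<Sigma>)
      show "(z, s) \<in> ball 0 1 \<times> \<Sigma>" using assms by simp
      show "h * D (0, 1) p = D (0, h) p" if "p \<in> ball 0 1 \<times> \<Sigma>" for p
        using g_field_derivative(2)[of "fst p" "snd p" h] that by auto
    qed
    from fun_cong[OF has_derivative_unique[OF this D_derivative[OF X]], of w] show ?thesis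
      by (rule sym)
  qed
  have eq: "DD (v, 0) (0, h) (z, s) = DD (0, 1) (v, 0) (z, s) * h" for h
    using DD_commute[OF X, of "(v, 0)" "(0, h)"] lin[of h "(v, 0)"] by (simp only: mult.commute)
  show ?thesis
    using has_derivative_slice_snd[OF D_derivative[OF X], of "(v, 0)"]
    by (simp add: has_field_derivative_def eq)
qed

lemma g_dz_dbar_field_derivative:
  assumes "z \<in> ball 0 1" "s \<in> \<Sigma>"
  shows "((\<lambda>s. g_dz (z, s)) has_field_derivative gs_dz (z, s)) (at s)"
    and "((\<lambda>s. g_dbar (z, s)) has_field_derivative gs_dbar (z, s)) (at s)"
  unfolding g_dz_def g_dbar_def gs_dz_def gs_dbar_def
  by (auto intro!: derivative_eq_intros D_field_derivative[OF assms])

text \<open>Restricted to the open disc: at a circle point \<open>f\<close> need not follow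
  \<open>g\<close> on the outer side.\<close>

lemma dz_dbar_slice:
  assumes "z \<in> ball 0 1" "s \<in> \<Sigma>" "\<And>z. z \<in> cball 0 1 \<Longrightarrow> f z = g (z, s)"
  shows "(f has_derivative (\<lambda>h. D (h, 0) (z, s))) (at z)"
    and "dz f z = g_dz (z, s)" and "dbar f z = g_dbar (z, s)"
proof -
  have X: "(z, s) \<in> X" using assms disc_subset by auto
  show f: "(f has_derivative (\<lambda>h. D (h, 0) (z, s))) (at z)"
    by (rule has_derivative_transform_within_open[OF has_derivative_slice_fst[OF g_derivative[OF X]]
        open_ball assms(1)]) (use assms(3) in auto)
  from frechet_derivative_at[OF this]
  have "frechet_derivative f (at z) = (\<lambda>h. D (h, 0) (z, s))" by simp
  then show "dz f z = g_dz (z, s)" "dbar f z = g_dbar (z, s)"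
    by (simp_all add: dz_def dbar_def g_dz_def g_dbar_def)
qed

lemma g_circle_vector_derivative:
  assumes "s \<in> \<Sigma>"
  shows "((\<lambda>\<theta>. g (cis \<theta>, s)) has_vector_derivative
    cos \<theta> *\<^sub>R D (\<i>, 0) (cis \<theta>, s) - sin \<theta> *\<^sub>R D (1, 0) (cis \<theta>, s)) (at \<theta>)"
proof -
  have X: "(cis \<theta>, s) \<in> X" using assms disc_subset by auto
  have lin: "linear (\<lambda>v. D v (cis \<theta>, s))"
    by (rule has_derivative_linear[OF g_derivative[OF X]])
  have "(cis has_derivative (\<lambda>h. h *\<^sub>R (\<i> * cis \<theta>))) (at \<theta>)"
    by (rule has_derivative_cis[OF has_derivative_ident])
  from has_derivative_compose[OF this has_derivative_slice_fst[OF g_derivative[OF X]]]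
  have "((\<lambda>\<theta>. g (cis \<theta>, s)) has_derivative (\<lambda>h. D (h *\<^sub>R (\<i> * cis \<theta>), 0) (cis \<theta>, s))) (at \<theta>)" .
  moreover have "D (h *\<^sub>R (\<i> * cis \<theta>), 0) (cis \<theta>, s) =
      h *\<^sub>R (cos \<theta> *\<^sub>R D (\<i>, 0) (cis \<theta>, s) - sin \<theta> *\<^sub>R D (1, 0) (cis \<theta>, s))" for h
  proof -
    have "(h *\<^sub>R (\<i> * cis \<theta>), 0) = h *\<^sub>R (cos \<theta> *\<^sub>R (\<i>, 0) - sin \<theta> *\<^sub>R (1, 0 :: complex))"
      by (simp add: complex_eq_iff)
    then show ?thesis
      by (simp only: linear_cmul[OF lin] linear_diff[OF lin])
  qed
  ultimately show ?thesis by (simp add: has_vector_derivative_def)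
qed

text \<open>A power of \<open>z\<close> is holomorphic and passes under the operator: the integrand
  is the \<open>d*\<close> derivative of \<open>z ^ m * g\<close>. The normal contributes
  \<open>cos \<theta> + \<i> * sin \<theta>\<close>, which raises the power by one.\<close>

lemma disc_integral_power_dbar:
  assumes "s \<in> \<Sigma>"
  shows "set_lebesgue_integral lborel (cball 0 1) (\<lambda>z. z ^ m * g_dbar (z, s)) =
    integral {0..2*pi} (\<lambda>\<theta>. cis \<theta> ^ Suc m * g (cis \<theta>, s)) / 2"
proof -
  have X: "(z, s) \<in> X" if "z \<in> cball 0 1" for z using that assms disc_subset by auto
  \<comment> \<open>The second summand, from differentiating \<open>z ^ m\<close>, drops out of
    \<open>F z 1 + \<i> * F z \<i>\<close> because \<open>1 + \<i> * \<i> = 0\<close>.\<close>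
  define F where "F z h = z ^ m * D (h, 0) (z, s) + of_nat m * z ^ (m - 1) * h * g (z, s)" for z h
  have F: "((\<lambda>z. z ^ m * g (z, s)) has_derivative F z) (at z)" if "z \<in> cball 0 1" for z
    unfolding F_def using has_derivative_slice_fst[OF g_derivative[OF X[OF that]]]
    by (auto intro!: derivative_eq_intros)
  have cF: "continuous_on (cball 0 1) (\<lambda>z. F z h)" for h
    unfolding F_def
    by (intro continuous_intros continuous_on_disc_slice[OF continuous_D assms]
        continuous_on_disc_slice[OF continuous_g assms])
  have cg: "continuous_on {0..2*pi} (\<lambda>\<theta>. g (cis \<theta>, s))"
    by (rule continuous_on_compose2[OF continuous_on_disc_slice[OF continuous_g assms]])
       (auto intro!: continuous_intros)
  have "set_lebesgue_integral lborel (cball 0 1) (\<lambda>z. z ^ m * g_dbar (z, s)) =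
      set_lebesgue_integral lborel (cball 0 1) (\<lambda>z. (F z 1 + \<i> * F z \<i>) / 2)"
  proof -
    have "z ^ m * g_dbar (z, s) = (F z 1 + \<i> * F z \<i>) / 2" for z
    proof -
      have "F z 1 + \<i> * F z \<i> = z ^ m * (D (1, 0) (z, s) + \<i> * D (\<i>, 0) (z, s)) +
          of_nat m * z ^ (m - 1) * g (z, s) * (1 + \<i> * \<i>)"
        unfolding F_def by (simp only: algebra_simps mult_1_left mult_1_right)
      then show ?thesis by (simp add: g_dbar_def)
    qed
    then show ?thesis by (simp only:)
  qed
  also have "\<dots> = (set_lebesgue_integral lborel (cball 0 1) (\<lambda>z. F z 1) +
      \<i> * set_lebesgue_integral lborel (cball 0 1) (\<lambda>z. F z \<i>)) / 2"
    by (simp add: set_integral_add set_integrable_lborel_continuous cF)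
  also have "\<dots> = (integral {0..2*pi} (\<lambda>\<theta>. cos \<theta> *\<^sub>R (cis \<theta> ^ m * g (cis \<theta>, s))) +
      \<i> * integral {0..2*pi} (\<lambda>\<theta>. sin \<theta> *\<^sub>R (cis \<theta> ^ m * g (cis \<theta>, s)))) / 2"
    by (simp only: disc_integral_partial_derivatives[OF F cF cF])
  also have "\<dots> = integral {0..2*pi} (\<lambda>\<theta>. cos \<theta> *\<^sub>R (cis \<theta> ^ m * g (cis \<theta>, s)) +
      \<i> * (sin \<theta> *\<^sub>R (cis \<theta> ^ m * g (cis \<theta>, s)))) / 2"
  proof -
    have "(\<lambda>\<theta>. cos \<theta> *\<^sub>R (cis \<theta> ^ m * g (cis \<theta>, s))) integrable_on {0..2*pi}"
      and "(\<lambda>\<theta>. \<i> * (sin \<theta> *\<^sub>R (cis \<theta> ^ m * g (cis \<theta>, s)))) integrable_on {0..2*pi}"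
      by (intro integrable_continuous_interval continuous_intros cg)+
    from Henstock_Kurzweil_Integration.integral_add[OF this] show ?thesis
      by (simp only: Henstock_Kurzweil_Integration.integral_mult_right)
  qed
  also have "(\<lambda>\<theta>. cos \<theta> *\<^sub>R (cis \<theta> ^ m * g (cis \<theta>, s)) +
      \<i> * (sin \<theta> *\<^sub>R (cis \<theta> ^ m * g (cis \<theta>, s)))) = (\<lambda>\<theta>. cis \<theta> ^ Suc m * g (cis \<theta>, s))"
  proof
    fix \<theta>
    have "cis \<theta> = of_real (cos \<theta>) + \<i> * of_real (sin \<theta>)" by (simp add: complex_eq_iff)
    then have "cis \<theta> ^ Suc m = (of_real (cos \<theta>) + \<i> * of_real (sin \<theta>)) * cis \<theta> ^ m" by simp
    then show "cos \<theta> *\<^sub>R (cis \<theta> ^ m * g (cis \<theta>, s)) + \<i> * (sin \<theta> *\<^sub>R (cis \<theta> ^ m * g (cis \<theta>, s))) =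
        cis \<theta> ^ Suc m * g (cis \<theta>, s)"
      by (simp add: scaleR_conv_of_real algebra_simps)
  qed
  finally show ?thesis .
qed

text \<open>With real partial derivatives the integrand is \<open>\<i> / 2\<close> times the
  Jacobian \<open>u_y g_x - u_x g_y\<close>. Equality of the mixed derivatives of \<open>g\<close>
  makes this the divergence \<open>(u g_x)_y - (u g_y)_x\<close>, whose boundary integral pairs
  \<open>u\<close> with the tangential derivative of \<open>g\<close>.\<close>

lemma disc_integral_jacobian:
  assumes "s \<in> \<Sigma>"
  shows "set_lebesgue_integral lborel (cball 0 1)
      (\<lambda>z. gs_dbar (z, s) * g_dz (z, s) - g_dbar (z, s) * gs_dz (z, s)) =
    - (\<i> / 2) * integral {0..2*pi} (\<lambda>\<theta>. D (0, 1) (cis \<theta>, s) *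
        (cos \<theta> *\<^sub>R D (\<i>, 0) (cis \<theta>, s) - sin \<theta> *\<^sub>R D (1, 0) (cis \<theta>, s)))"
proof -
  let ?u = "\<lambda>z. D (0, 1) (z, s)" and ?gx = "\<lambda>z. D (1, 0) (z, s)" and ?gy = "\<lambda>z. D (\<i>, 0) (z, s)"
  let ?ux = "\<lambda>z. DD (0, 1) (1, 0) (z, s)" and ?uy = "\<lambda>z. DD (0, 1) (\<i>, 0) (z, s)"
  note cont = continuous_on_disc_slice[OF continuous_D assms] continuous_on_disc_slice[OF continuous_DD assms]
  have X: "(z, s) \<in> X" if "z \<in> cball 0 1" for z using that assms disc_subset by auto
  define F where "F v z h = ?u z * DD (v, 0) (h, 0) (z, s) + DD (0, 1) (h, 0) (z, s) * D (v, 0) (z, s)" for v z h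
  have F: "((\<lambda>z. ?u z * D (v, 0) (z, s)) has_derivative F v z) (at z)" if "z \<in> cball 0 1" for v z
    unfolding F_def using has_derivative_slice_fst[OF D_derivative[OF X[OF that]]]
    by (auto intro!: derivative_eq_intros)
  have cF: "continuous_on (cball 0 1) (\<lambda>z. F v z h)" for v h
    unfolding F_def by (intro continuous_intros cont)
  have cu: "continuous_on {0..2*pi} (\<lambda>\<theta>. D v (cis \<theta>, s))" for v
    by (rule continuous_on_compose2[OF cont(1)]) (auto intro!: continuous_intros)
  have "set_lebesgue_integral lborel (cball 0 1) (\<lambda>z. gs_dbar (z, s) * g_dz (z, s) - g_dbar (z, s) * gs_dz (z, s)) =
      set_lebesgue_integral lborel (cball 0 1) (\<lambda>z. \<i> / 2 * (F 1 z \<i> - F \<i> z 1))"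
  proof (rule set_lebesgue_integral_cong)
    show "\<forall>z. z \<in> cball 0 1 \<longrightarrow> gs_dbar (z, s) * g_dz (z, s) - g_dbar (z, s) * gs_dz (z, s) =
        \<i> / 2 * (F 1 z \<i> - F \<i> z 1)"
    proof (intro allI impI)
      fix z :: complex assume "z \<in> cball 0 1"
      have "F 1 z \<i> - F \<i> z 1 = ?uy z * ?gx z - ?ux z * ?gy z"
        using DD_commute[OF X[OF \<open>z \<in> cball 0 1\<close>], of "(1, 0)" "(\<i>, 0)"] by (simp add: F_def)
      moreover have "gs_dbar (z, s) * g_dz (z, s) - g_dbar (z, s) * gs_dz (z, s) =
          \<i> / 2 * (?uy z * ?gx z - ?ux z * ?gy z)"
        by (simp add: gs_dbar_def g_dz_def g_dbar_def gs_dz_def field_simps)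
      ultimately show "gs_dbar (z, s) * g_dz (z, s) - g_dbar (z, s) * gs_dz (z, s) =
          \<i> / 2 * (F 1 z \<i> - F \<i> z 1)"
        by simp
    qed
  qed simp
  also have "\<dots> = \<i> / 2 * (set_lebesgue_integral lborel (cball 0 1) (\<lambda>z. F 1 z \<i>) -
      set_lebesgue_integral lborel (cball 0 1) (\<lambda>z. F \<i> z 1))"
    by (simp add: set_integral_diff set_integrable_lborel_continuous cF)
  also have "\<dots> = \<i> / 2 * (integral {0..2*pi} (\<lambda>\<theta>. sin \<theta> *\<^sub>R (?u (cis \<theta>) * ?gx (cis \<theta>))) -
      integral {0..2*pi} (\<lambda>\<theta>. cos \<theta> *\<^sub>R (?u (cis \<theta>) * ?gy (cis \<theta>))))"
    by (simp only: disc_integral_partial_derivatives(2)[OF F cF cF]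
        disc_integral_partial_derivatives(1)[OF F cF cF])
  also have "integral {0..2*pi} (\<lambda>\<theta>. sin \<theta> *\<^sub>R (?u (cis \<theta>) * ?gx (cis \<theta>))) -
      integral {0..2*pi} (\<lambda>\<theta>. cos \<theta> *\<^sub>R (?u (cis \<theta>) * ?gy (cis \<theta>))) =
      integral {0..2*pi} (\<lambda>\<theta>. sin \<theta> *\<^sub>R (?u (cis \<theta>) * ?gx (cis \<theta>)) - cos \<theta> *\<^sub>R (?u (cis \<theta>) * ?gy (cis \<theta>)))"
    by (intro Henstock_Kurzweil_Integration.integral_diff[symmetric] integrable_continuous_interval
        continuous_intros cu)
  also have "\<dots> = integral {0..2*pi} (\<lambda>\<theta>. - (?u (cis \<theta>) * (cos \<theta> *\<^sub>R ?gy (cis \<theta>) - sin \<theta> *\<^sub>R ?gx (cis \<theta>))))"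
    by (simp only: right_diff_distrib mult_scaleR_right minus_diff_eq)
  finally show ?thesis
    by (simp only: Henstock_Kurzweil_Integration.integral_neg mult_minus_left mult_minus_right)
qed

end

section \<open>The time derivatives of the action\<close>

text \<open>The action integrates over the closed disc, yet on the circle its integrand may be
  evaluated where \<open>St t\<close> is not differentiable. The sphere is negligible, so those
  values are harmless.\<close>

lemma set_lebesgue_integral_ball_eq_cball:
  fixes f :: "'a::euclidean_space \<Rightarrow> 'b::euclidean_space"
  assumes "set_integrable lebesgue (ball a r) f"
  shows "set_lebesgue_integral lebesgue (cball a r) f = set_lebesgue_integral lebesgue (ball a r) f"
proof -
  have neg: "negligible (sphere a r)" by (rule negligible_sphere)
  have n1: "negligible {x \<in> ball a r - cball a r. f x \<noteq> 0}"
    and n2: "negligible {x \<in> cball a r - ball a r. f x \<noteq> 0}"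
    by (rule negligible_subset[OF neg]; force)+
  have "set_integrable lebesgue (cball a r) f"
    by (rule absolutely_integrable_spike_set[OF assms n1 n2])
  then have "set_lebesgue_integral lebesgue (cball a r) f = integral (cball a r) f"
    by (rule set_lebesgue_integral_eq_integral)
  also have "\<dots> = integral (ball a r) f"
    by (rule integral_spike_set[OF n2 n1])
  also have "\<dots> = set_lebesgue_integral lebesgue (ball a r) f"
    by (rule set_lebesgue_integral_eq_integral(2)[OF assms, symmetric])
  finally show ?thesis .
qed

lemma set_lebesgue_continuous:
  fixes f :: "'a::euclidean_space \<Rightarrow> 'b::{banach, second_countable_topology}"
  assumes "compact A" "continuous_on A f"
  shows "set_integrable lebesgue A f"
    and "set_lebesgue_integral lebesgue A f = set_lebesgue_integral lborel A f"
proof -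
  have 1: "integrable lborel (\<lambda>x. indicator A x *\<^sub>R f x)"
    by (rule borel_integrable_compact[OF assms])
  then have 2: "(\<lambda>x. indicator A x *\<^sub>R f x) \<in> borel_measurable lborel"
    by (rule borel_measurable_integrable)
  show "set_integrable lebesgue A f"
    unfolding set_integrable_def using integrable_completion[OF 2] 1 by simp
  show "set_lebesgue_integral lebesgue A f = set_lebesgue_integral lborel A f"
    unfolding set_lebesgue_integral_def by (rule integral_completion[OF 2])
qed

text \<open>Zero coefficients at the even exponents make the odd series an ordinary power series,
  convergent everywhere.\<close>

lemma S0_holomorphic:
  assumes "\<And>z. summable (\<lambda>n. t n * z ^ (2 * n + 1))"
  shows "S0 t holomorphic_on UNIV"
proof -
  define a where "a m = (if odd m then t (m div 2) else 0)" for m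
  have "S0 t holomorphic_on ball 0 r" for r
  proof (rule power_series_holomorphic)
    fix z :: complex
    have "(\<lambda>n. a (2 * n + 1) * z ^ (2 * n + 1)) sums S0 t z"
      unfolding S0_def a_def using summable_sums[OF assms[of z]] by simp
    then have "(\<lambda>m. a m * z ^ m) sums S0 t z"
      by (subst (asm) sums_mono_reindex[where g = "\<lambda>n. 2 * n + 1" and f = "\<lambda>m. a m * z ^ m"])
         (auto simp: strict_mono_def a_def elim!: oddE)
    then show "(\<lambda>m. a m * (z - 0) ^ m) sums S0 t z" by simp
  qed
  then have "S0 t field_differentiable at z" for z
    by (rule holomorphic_on_imp_differentiable_at[of _ "ball 0 (norm z + 1)"]) auto
  then show ?thesis
    by (auto simp: holomorphic_on_def field_differentiable_at_within)
qed

lemma S0_fun_upd: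
  assumes "summable (\<lambda>n. t n * z ^ (2 * n + 1))"
  shows "S0 (t(n := s)) z = S0 t z + (s - t n) * z ^ (2 * n + 1)"
proof -
  have "(\<lambda>m. t m * z ^ (2 * m + 1) + (if m = n then (s - t m) * z ^ (2 * m + 1) else 0)) sums
      (S0 t z + (s - t n) * z ^ (2 * n + 1))"
    unfolding S0_def
    by (rule sums_add[OF summable_sums[OF assms] sums_single])
  moreover have "t m * z ^ (2 * m + 1) + (if m = n then (s - t m) * z ^ (2 * m + 1) else 0) =
      (t(n := s)) m * z ^ (2 * m + 1)" for m
    by (simp add: algebra_simps)
  ultimately show ?thesis
    unfolding S0_def by (simp only: sums_unique[symmetric])
qed

text \<open>The factor 1/2 of the quadratic term is what makes the variation antisymmetric:
  \<open>(d* u \<cdot> d S + d* S \<cdot> d u) / 2\<close> minus the \<open>d* S \<cdot> d u\<close>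
  contributed by \<open>W1\<close>. Only the explicit variation of \<open>S0\<close> then
  survives.\<close>

lemma beltrami_action_time_derivative:
  fixes W W1 :: "complex \<Rightarrow> complex \<Rightarrow> complex"
  assumes W1: "\<And>z \<eta>. (W1 z has_field_derivative W z \<eta>) (at \<eta>)"
    and T: "time_domain T"
    and sol: "dBKP_beltrami_solution W T St"
    and int: "\<And>t. t \<in> T \<Longrightarrow> set_integrable lebesgue unit_disc (\<lambda>z. W1 z (dz (full_S St t) z))"
    and t: "t \<in> T"
  shows "((\<lambda>s. beltrami_action W1 St (t(n := s))) has_field_derivative
    - (of_nat (2 * n + 1) * ((deriv ^^ (2 * n + 1)) (at_inverse (St t)) 0 / fact (2 * n + 1)))) (at (t n))"
proof -
  define A where "A = (deriv ^^ (2 * n + 1)) (at_inverse (St t)) 0 / fact (2 * n + 1)"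
  define \<Sigma> where "\<Sigma> = {s. t(n := s) \<in> T}"
  have open_\<Sigma>: "open \<Sigma>" and summ: "\<And>z. summable (\<lambda>n. t n * z ^ (2 * n + 1))"
    using T t by (auto simp: time_domain_def \<Sigma>_def)
  have tn: "t n \<in> \<Sigma>" using t by (simp add: \<Sigma>_def)
  have upd: "t(n := s) \<in> T" if "s \<in> \<Sigma>" for s using that by (simp add: \<Sigma>_def)
  have cont_St: "continuous_on UNIV (St t')" and hol_St: "St t' holomorphic_on - cball 0 1"
    and ser_St: "\<exists>c. \<forall>\<^sub>F z in at_infinity. (\<lambda>i. c i / z ^ Suc i) sums St t' z"
    and belt: "\<And>z. norm z \<noteq> 1 \<Longrightarrow> dbar (full_S St t') z = W z (dz (full_S St t') z)"
    if "t' \<in> T" for t'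
    using sol that by (auto simp: dBKP_beltrami_solution_def unit_disc_def)
  have inv_St: "at_inverse (St t') holomorphic_on ball 0 1" if "t' \<in> T" for t'
    using ser_St[OF that] at_inverse_holomorphic[OF hol_St[OF that]] by blast
  have "C2_up_to_boundary (\<lambda>(z, s). St (t(n := s)) z) (cball 0 1 \<times> \<Sigma>)"
    and hol_s: "\<And>z. z \<in> cball 0 1 \<Longrightarrow> (\<lambda>s. St (t(n := s)) z) holomorphic_on \<Sigma>"
    using sol t by (auto simp: dBKP_beltrami_solution_def unit_disc_def \<Sigma>_def)
  then obtain X g where X: "open X" "cball 0 1 \<times> \<Sigma> \<subseteq> X" "C2_on g X"
    and "\<And>p. p \<in> cball 0 1 \<times> \<Sigma> \<Longrightarrow> g p = (case p of (z, s) \<Rightarrow> St (t(n := s)) z)"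
    unfolding C2_up_to_boundary_def by blast
  then have St: "St (t(n := s)) z = g (z, s)" if "z \<in> cball 0 1" "s \<in> \<Sigma>" for z s
    using that by auto
  interpret holomorphic_disc_family X g \<Sigma>
  proof
    show "(\<lambda>s. g (z, s)) holomorphic_on \<Sigma>" if "z \<in> cball 0 1" for z
      by (rule holomorphic_transform[OF hol_s[OF that]]) (use St that in auto)
  qed (use X open_\<Sigma> in auto)
  \<comment> \<open>\<open>S0\<close> is affine in the varied time: \<open>Q\<close> is its
    derivative in \<open>z\<close> at \<open>t\<close>, and \<open>c\<close> that of
    \<open>z ^ (2 * n + 1)\<close>.\<close>
  define Q where "Q = deriv (S0 t)"
  define c where "c z = of_nat (2 * n + 1) * z ^ (2 * n)" for z :: complex
  have full: "dz (full_S St (t(n := s))) z = Q z + (s - t n) * c z + g_dz (z, s)"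
      "dbar (full_S St (t(n := s))) z = g_dbar (z, s)"
    if "z \<in> ball 0 1" "s \<in> \<Sigma>" for z s
  proof -
    have "(S0 t has_field_derivative Q z) (at z)"
      unfolding Q_def by (rule holomorphic_derivI[OF S0_holomorphic[OF summ] open_UNIV UNIV_I])
    moreover have "((\<lambda>z. z ^ (2 * n + 1)) has_field_derivative c z) (at z)"
      using DERIV_power[OF DERIV_ident, of "2 * n + 1" z] by (simp add: c_def)
    ultimately have "((\<lambda>z. S0 t z + (s - t n) * z ^ (2 * n + 1)) has_field_derivative Q z + (s - t n) * c z) (at z)"
      by (intro DERIV_add DERIV_cmult)
    then have 1: "((\<lambda>z. S0 t z + (s - t n) * z ^ (2 * n + 1)) has_derivative (*) (Q z + (s - t n) * c z)) (at z)"
      by (simp add: has_field_derivative_def)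
    have 2: "(St (t(n := s)) has_derivative (\<lambda>h. D (h, 0) (z, s))) (at z)"
      by (rule dz_dbar_slice[OF that St]) (use that in auto)
    have "full_S St (t(n := s)) = (\<lambda>z. S0 t z + (s - t n) * z ^ (2 * n + 1) + St (t(n := s)) z)"
      unfolding full_S_def S0_fun_upd[OF summ] ..
    then have "(full_S St (t(n := s)) has_derivative (\<lambda>h. (Q z + (s - t n) * c z) * h + D (h, 0) (z, s))) (at z)"
      using has_derivative_add[OF 1 2] by simp
    from frechet_derivative_at[OF this]
    have "frechet_derivative (full_S St (t(n := s))) (at z) =
        (\<lambda>h. (Q z + (s - t n) * c z) * h + D (h, 0) (z, s))" by simp
    then show "dz (full_S St (t(n := s))) z = Q z + (s - t n) * c z + g_dz (z, s)"
      "dbar (full_S St (t(n := s))) z = g_dbar (z, s)"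
      by (simp_all add: dz_def dbar_def g_dz_def g_dbar_def field_simps)
  qed
  have W: "W z (Q z + (s - t n) * c z + g_dz (z, s)) = g_dbar (z, s)" if "z \<in> ball 0 1" "s \<in> \<Sigma>" for z s
    using belt[OF upd[OF that(2)], of z] full[OF that] that(1) by simp
  define H where "H s z = 1 / 2 * g_dbar (z, s) * g_dz (z, s) - W1 z (Q z + (s - t n) * c z + g_dz (z, s))" for s z
  \<comment> \<open>\<open>W\<close> has been eliminated here, so \<open>H'\<close> is continuous up
    to the circle although \<open>H\<close> need not be.\<close>
  define H' where "H' s z = 1 / 2 * (gs_dbar (z, s) * g_dz (z, s) - g_dbar (z, s) * gs_dz (z, s)) -
      c z * g_dbar (z, s)" for s z
  have H': "((\<lambda>s. H s z) has_field_derivative H' s z) (at s)" if "z \<in> ball 0 1" "s \<in> \<Sigma>" for z s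
  proof -
    note d = g_dz_dbar_field_derivative[OF that]
    have "((\<lambda>s. Q z + (s - t n) * c z + g_dz (z, s)) has_field_derivative c z + gs_dz (z, s)) (at s)"
      using d(1) by (auto intro!: derivative_eq_intros)
    from DERIV_chain2[OF W1[of z] this]
    have "((\<lambda>s. W1 z (Q z + (s - t n) * c z + g_dz (z, s))) has_field_derivative
        g_dbar (z, s) * (c z + gs_dz (z, s))) (at s)"
      by (simp only: W[OF that])
    with d show ?thesis
      unfolding H_def H'_def by (auto intro!: derivative_eq_intros simp: field_simps)
  qed
  have intH: "set_integrable lebesgue (ball 0 1) (H s)" if "s \<in> \<Sigma>" for s
  proof -
    have "set_integrable lebesgue (cball 0 1) (\<lambda>z. 1 / 2 * g_dbar (z, s) * g_dz (z, s))"
      by (intro set_lebesgue_continuous(1) compact_cball continuous_intros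
          continuous_on_disc_slice[OF _ that] continuous_dz_dbar)
    moreover have "set_integrable lebesgue (cball 0 1) (\<lambda>z. W1 z (dz (full_S St (t(n := s))) z))"
      using int[OF upd[OF that]] by (simp add: unit_disc_def)
    ultimately have "set_integrable lebesgue (cball 0 1)
        (\<lambda>z. 1 / 2 * g_dbar (z, s) * g_dz (z, s) - W1 z (dz (full_S St (t(n := s))) z))"
      by (rule set_integral_diff)
    then have "set_integrable lebesgue (ball 0 1)
        (\<lambda>z. 1 / 2 * g_dbar (z, s) * g_dz (z, s) - W1 z (dz (full_S St (t(n := s))) z))"
      by (rule set_integrable_subset) auto
    then show ?thesis
      by (rule iffD1[OF set_integrable_cong, rotated -1]) (auto simp: H_def full that)
  qed
  \<comment> \<open>The constant is \<open>- 1 / (2 * pi * \<i>)\<close> times the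
    \<open>- 2 * \<i>\<close> of the area form, that is, \<open>1 / pi\<close>.\<close>
  have action: "beltrami_action W1 St (t(n := s)) = set_lebesgue_integral lebesgue (ball 0 1) (H s) / pi"
    if "s \<in> \<Sigma>" for s
  proof -
    let ?f = "\<lambda>z. 1 / 2 * dbar (St (t(n := s))) z * dz (St (t(n := s))) z - W1 z (dz (full_S St (t(n := s))) z)"
    have eq: "?f z = H s z" if z: "z \<in> ball 0 1" for z
      using dz_dbar_slice(2,3)[OF z \<open>s \<in> \<Sigma>\<close> St] full[OF z \<open>s \<in> \<Sigma>\<close>] \<open>s \<in> \<Sigma>\<close> by (simp add: H_def)
    have "set_integrable lebesgue (ball 0 1) ?f \<longleftrightarrow> set_integrable lebesgue (ball 0 1) (H s)"
      by (intro set_integrable_cong refl eq)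
    then have "set_integrable lebesgue (ball 0 1) ?f"
      using intH[OF that] by (rule iffD2)
    then have "set_lebesgue_integral lebesgue (cball 0 1) ?f = set_lebesgue_integral lebesgue (ball 0 1) ?f"
      by (rule set_lebesgue_integral_ball_eq_cball)
    also have "\<dots> = set_lebesgue_integral lebesgue (ball 0 1) (H s)"
      by (rule set_lebesgue_integral_cong) (use eq in auto)
    finally show ?thesis
      by (simp add: beltrami_action_def wedge_integral_def unit_disc_def)
  qed
  \<comment> \<open>A closed ball of times makes the domain of \<open>H'\<close> compact, which
    supplies the constant dominating function.\<close>
  obtain \<rho> where \<rho>: "\<rho> > 0" "cball (t n) \<rho> \<subseteq> \<Sigma>"
    using open_\<Sigma> tn by (meson open_contains_cball)
  have cH': "continuous_on (cball 0 1) (H' s)" if "s \<in> \<Sigma>" for s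
    unfolding H'_def[abs_def] c_def
    by (intro continuous_intros continuous_on_disc_slice[OF _ that] continuous_dz_dbar)
  obtain B where B: "\<And>z s. z \<in> cball 0 1 \<Longrightarrow> s \<in> cball (t n) \<rho> \<Longrightarrow> norm (H' s z) \<le> B"
  proof -
    have "continuous_on (cball 0 1 \<times> cball (t n) \<rho>) (\<lambda>p. H' (snd p) (fst p))"
      unfolding H'_def c_def prod.collapse
      by (intro continuous_intros continuous_on_subset[OF continuous_dz_dbar(1)]
          continuous_on_subset[OF continuous_dz_dbar(2)] continuous_on_subset[OF continuous_dz_dbar(3)]
          continuous_on_subset[OF continuous_dz_dbar(4)])
         (use \<rho>(2) disc_subset in \<open>auto\<close>)
    then have "compact ((\<lambda>p. H' (snd p) (fst p)) ` (cball 0 1 \<times> cball (t n) \<rho>))"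
      by (intro compact_continuous_image compact_Times compact_cball)
    then obtain B where "\<forall>x\<in>(\<lambda>p. H' (snd p) (fst p)) ` (cball 0 1 \<times> cball (t n) \<rho>). norm x \<le> B"
      using compact_imp_bounded bounded_iff by metis
    then show ?thesis by (intro that[of B]) force
  qed
  have "((\<lambda>s. set_lebesgue_integral lebesgue (ball 0 1) (H s)) has_field_derivative
      set_lebesgue_integral lebesgue (ball 0 1) (H' (t n))) (at (t n))"
    unfolding set_lebesgue_integral_def
  proof (rule has_field_derivative_lebesgue_integral[OF \<rho>(1), where m = "\<lambda>z. indicator (ball 0 1) z *\<^sub>R \<bar>B\<bar>"])
    fix s assume s: "s \<in> ball (t n) \<rho>"
    then have s': "s \<in> \<Sigma>" "s \<in> cball (t n) \<rho>" using \<rho>(2) by auto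
    show "integrable lebesgue (\<lambda>z. indicator (ball 0 1) z *\<^sub>R H s z)"
      using intH[OF s'(1)] by (simp add: set_integrable_def)
    fix z :: complex
    show "((\<lambda>s. indicator (ball 0 1) z *\<^sub>R H s z) has_field_derivative indicator (ball 0 1) z *\<^sub>R H' s z) (at s)"
      using H'[OF _ s'(1), of z] by (cases "z \<in> ball 0 1") auto
    show "norm (indicator (ball 0 1) z *\<^sub>R H' s z) \<le> indicator (ball 0 1) z *\<^sub>R \<bar>B\<bar>"
      using B[OF _ s'(2), of z] by (cases "z \<in> ball 0 1") auto
  next
    have "integrable lebesgue (indicator (ball 0 1 :: complex set) :: complex \<Rightarrow> real)"
      using emeasure_lborel_ball_finite[of "0 :: complex" 1] by (intro integrable_real_indicator) auto
    then show "integrable lebesgue (\<lambda>z::complex. indicator (ball 0 1) z *\<^sub>R \<bar>B\<bar>)"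
      by simp
  qed
  then have "((\<lambda>s. set_lebesgue_integral lebesgue (ball 0 1) (H s) / pi) has_field_derivative
      set_lebesgue_integral lebesgue (ball 0 1) (H' (t n)) / pi) (at (t n))"
    by (rule DERIV_cdivide)
  then have der: "((\<lambda>s. beltrami_action W1 St (t(n := s))) has_field_derivative
      set_lebesgue_integral lebesgue (ball 0 1) (H' (t n)) / pi) (at (t n))"
    by (rule has_field_derivative_transform_within_open[OF _ open_\<Sigma> tn]) (simp add: action)
  define dv where "dv \<theta> = cos \<theta> *\<^sub>R D (\<i>, 0) (cis \<theta>, t n) - sin \<theta> *\<^sub>R D (1, 0) (cis \<theta>, t n)" for \<theta>
  have cDc: "continuous_on UNIV (\<lambda>\<theta>. D v (cis \<theta>, t n))" for v
    by (rule continuous_on_compose2[OF continuous_on_disc_slice[OF continuous_D tn]])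
       (auto intro!: continuous_intros)
  have cdv: "continuous_on UNIV dv"
    unfolding dv_def by (intro continuous_intros cDc)
  have dv: "((\<lambda>\<theta>. St t (cis \<theta>)) has_vector_derivative dv \<theta>) (at \<theta>)" for \<theta>
    using g_circle_vector_derivative[OF tn] St[OF _ tn] by (simp add: dv_def)
  have orth: "integral {0..2*pi} (\<lambda>\<theta>. g (cis \<theta>, s) * dv \<theta>) = 0" if "s \<in> \<Sigma>" for s
    using at_inverse_boundary_orthogonality[OF cont_St[OF t] inv_St[OF t] cont_St[OF upd[OF that]]
        inv_St[OF upd[OF that]] dv cdv] that by (simp add: St)
  \<comment> \<open>By \<open>orth\<close> the integral against \<open>g\<close> vanishes for every
    \<open>s\<close> in the open set \<open>\<Sigma>\<close>; differentiating that identity replaces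
    \<open>g\<close> by its derivative \<open>u\<close>.\<close>
  have "integral {0..2*pi} (\<lambda>\<theta>. D (0, 1) (cis \<theta>, t n) * dv \<theta>) = 0"
  proof -
    let ?U = "ball (t n) \<rho>"
    have U: "t n \<in> ?U" "?U \<subseteq> \<Sigma>" using \<rho> by auto
    have "((\<lambda>s. integral (cbox 0 (2*pi)) (\<lambda>\<theta>. g (cis \<theta>, s) * dv \<theta>)) has_field_derivative
        integral (cbox 0 (2*pi)) (\<lambda>\<theta>. D (0, 1) (cis \<theta>, t n) * dv \<theta>)) (at (t n) within ?U)"
    proof (rule leibniz_rule_field_derivative)
      show "((\<lambda>s. g (cis \<theta>, s) * dv \<theta>) has_field_derivative D (0, 1) (cis \<theta>, s) * dv \<theta>) (at s within ?U)"
        if "s \<in> ?U" for s \<theta>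
        by (intro DERIV_cmult_right has_field_derivative_at_within[OF g_field_derivative(1)])
           (use that U in auto)
      show "(\<lambda>\<theta>. g (cis \<theta>, s) * dv \<theta>) integrable_on cbox 0 (2*pi)" if "s \<in> ?U" for s
        by (intro integrable_continuous continuous_intros continuous_on_subset[OF cdv]
            continuous_on_compose2[OF continuous_on_disc_slice[OF continuous_g]])
           (use that U in auto)
      have "(cis \<theta>, s) \<in> X" if "s \<in> ?U" for s \<theta>
        using subsetD[OF disc_subset, of "(cis \<theta>, s)"] subsetD[OF U(2) that] by simp
      then have "continuous_on (?U \<times> cbox 0 (2*pi)) (\<lambda>p. D (0, 1) (cis (snd p), fst p) * dv (snd p))"
        by (intro continuous_intros continuous_on_compose2[OF continuous_D] continuous_on_compose2[OF cdv])
           auto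
      then show "continuous_on (?U \<times> cbox 0 (2*pi)) (\<lambda>(s, \<theta>). D (0, 1) (cis \<theta>, s) * dv \<theta>)"
        by (simp add: split_beta)
    qed (use U in auto)
    then have "((\<lambda>s. integral {0..2*pi} (\<lambda>\<theta>. g (cis \<theta>, s) * dv \<theta>)) has_field_derivative
        integral {0..2*pi} (\<lambda>\<theta>. D (0, 1) (cis \<theta>, t n) * dv \<theta>)) (at (t n))"
      using at_within_open[OF U(1) open_ball] by simp
    moreover have "((\<lambda>s. integral {0..2*pi} (\<lambda>\<theta>. g (cis \<theta>, s) * dv \<theta>)) has_field_derivative 0) (at (t n))"
      by (rule has_field_derivative_transform_within_open[OF DERIV_const[of 0] open_\<Sigma> tn]) (simp add: orth)
    ultimately show ?thesis by (rule DERIV_unique)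
  qed
  then have jac: "set_lebesgue_integral lborel (cball 0 1)
      (\<lambda>z. gs_dbar (z, t n) * g_dz (z, t n) - g_dbar (z, t n) * gs_dz (z, t n)) = 0"
    using disc_integral_jacobian[OF tn] by (simp add: dv_def)
  have pw: "set_lebesgue_integral lborel (cball 0 1) (\<lambda>z. z ^ (2 * n) * g_dbar (z, t n)) =
      pi * ((deriv ^^ (2 * n + 1)) (at_inverse (St t)) 0 / fact (2 * n + 1))"
  proof -
    have "set_lebesgue_integral lborel (cball 0 1) (\<lambda>z. z ^ (2 * n) * g_dbar (z, t n)) =
        integral {0..2*pi} (\<lambda>\<theta>. at_inverse (St t) (cis (- \<theta>)) * cis \<theta> ^ (2 * n + 1)) / 2"
      using disc_integral_power_dbar[OF tn, of "2 * n"] St[OF _ tn]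
      by (simp add: at_inverse_cis mult.commute)
    also have "\<dots> = 2 * pi * (deriv ^^ (2 * n + 1)) (at_inverse (St t)) 0 / fact (2 * n + 1) / 2"
      by (simp only: disc_fourier_coefficient[OF at_inverse_continuous[OF cont_St[OF t] inv_St[OF t]] inv_St[OF t]])
    finally show ?thesis by simp
  qed
  have "set_lebesgue_integral lebesgue (ball 0 1) (H' (t n)) = set_lebesgue_integral lebesgue (cball 0 1) (H' (t n))"
    by (rule set_lebesgue_integral_ball_eq_cball[symmetric],
        rule set_integrable_subset[OF set_lebesgue_continuous(1)[OF compact_cball cH'[OF tn]]]) auto
  also have "\<dots> = set_lebesgue_integral lborel (cball 0 1) (H' (t n))"
    by (rule set_lebesgue_continuous(2)[OF compact_cball cH'[OF tn]])
  also have "\<dots> = set_lebesgue_integral lborel (cball 0 1)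
      (\<lambda>z. 1 / 2 * (gs_dbar (z, t n) * g_dz (z, t n) - g_dbar (z, t n) * gs_dz (z, t n)) -
        of_nat (2 * n + 1) * (z ^ (2 * n) * g_dbar (z, t n)))"
    by (simp only: H'_def[abs_def] c_def mult.assoc)
  also have "\<dots> = 1 / 2 * set_lebesgue_integral lborel (cball 0 1)
      (\<lambda>z. gs_dbar (z, t n) * g_dz (z, t n) - g_dbar (z, t n) * gs_dz (z, t n)) -
      of_nat (2 * n + 1) * set_lebesgue_integral lborel (cball 0 1) (\<lambda>z. z ^ (2 * n) * g_dbar (z, t n))"
  proof -
    have "set_integrable lborel (cball 0 1)
        (\<lambda>z. 1 / 2 * (gs_dbar (z, t n) * g_dz (z, t n) - g_dbar (z, t n) * gs_dz (z, t n)))"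
      "set_integrable lborel (cball 0 1) (\<lambda>z. of_nat (2 * n + 1) * (z ^ (2 * n) * g_dbar (z, t n)))"
      by (rule set_integrable_lborel_continuous[OF compact_cball],
          intro continuous_intros continuous_on_disc_slice[OF _ tn] continuous_dz_dbar)+
    from set_integral_diff(2)[OF this] show ?thesis
      by (simp only: set_integral_mult_right)
  qed
  finally have "set_lebesgue_integral lebesgue (ball 0 1) (H' (t n)) =
      1 / 2 * 0 - of_nat (2 * n + 1) * (pi * A)"
    unfolding jac pw A_def .
  then have "set_lebesgue_integral lebesgue (ball 0 1) (H' (t n)) / pi = - (of_nat (2 * n + 1) * A)"
    by (simp del: of_nat_add of_nat_mult of_nat_Suc)
  with der show ?thesis unfolding A_def by (simp only:)
qed

section \<open>Laurent expansion outside the disc and the vertex operator\<close>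

text \<open>The Taylor series of \<open>at_inverse f\<close> converges in the whole unit disc, hence
  the expansion holds for all \<open>norm z > 1\<close> and not only near infinity. Half the
  difference of the series at \<open>1 / z\<close> and \<open>- 1 / z\<close> removes the even
  powers.\<close>

lemma at_inverse_odd_sums:
  assumes hol: "at_inverse f holomorphic_on ball 0 1"
    and odd: "\<And>z. f (- z) = - f z" and z: "norm z > 1"
  shows "(\<lambda>n. (deriv ^^ (2 * n + 1)) (at_inverse f) 0 / fact (2 * n + 1) / z ^ (2 * n + 1)) sums f z"
proof -
  define a where "a m = (deriv ^^ m) (at_inverse f) 0 / fact m" for m
  have "z \<noteq> 0" using z by auto
  have ser: "(\<lambda>m. a m * w ^ m) sums at_inverse f w" if "norm w < 1" for w
    using holomorphic_power_series[OF hol, of w] that by (simp add: a_def)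
  let ?w = "1 / z"
  have w: "norm ?w < 1" using z by (simp add: norm_divide divide_less_eq)
  have "at_inverse f (- ?w) = - at_inverse f ?w"
    using odd[of z] \<open>z \<noteq> 0\<close> by (simp add: at_inverse_def)
  then have "(\<lambda>m. (a m * ?w ^ m - a m * (- ?w) ^ m) / 2) sums at_inverse f ?w"
    using sums_divide[OF sums_diff[OF ser[OF w] ser[of "- ?w"]], of 2] w by simp
  moreover have "(a m * ?w ^ m - a m * (- ?w) ^ m) / 2 = (if odd m then a m * ?w ^ m else 0)" for m
    by (cases "odd m") auto
  ultimately have "(\<lambda>m. if odd m then a m * ?w ^ m else 0) sums f z"
    using \<open>z \<noteq> 0\<close> by (simp add: at_inverse_def)
  then have "(\<lambda>n. if odd (2 * n + 1) then a (2 * n + 1) * ?w ^ (2 * n + 1) else 0) sums f z"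
    by (subst sums_mono_reindex[where g = "\<lambda>n. 2 * n + 1"
          and f = "\<lambda>m. if odd m then a m * ?w ^ m else 0"])
       (auto simp: strict_mono_def elim!: oddE)
  then show ?thesis
    using \<open>z \<noteq> 0\<close> by (simp add: a_def power_one_over field_simps)
qed

theorem proposition1:
  fixes W W1 :: "complex \<Rightarrow> complex \<Rightarrow> complex"
    and T :: "(nat \<Rightarrow> complex) set"
    and St :: "(nat \<Rightarrow> complex) \<Rightarrow> complex \<Rightarrow> complex"
  assumes "localized_in_disc W"
    and "\<And>z \<eta>. W (- z) \<eta> = W z \<eta>"
    and "\<And>z \<eta>. (W1 z has_field_derivative W z \<eta>) (at \<eta>)"
    and "time_domain T"
    and "dBKP_beltrami_solution W T St"
    and "\<And>t. t \<in> T \<Longrightarrow> set_integrable lebesgue unit_disc (\<lambda>z. W1 z (dz (full_S St t) z))"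
  shows "dBKP_tau_function T St (\<lambda>t. beltrami_action W1 St t / 2)"
  unfolding dBKP_tau_function_def
proof (intro ballI conjI allI impI)
  fix t n assume t: "t \<in> T"
  let ?F = "\<lambda>t. beltrami_action W1 St t / 2"
  define A where "A n = (deriv ^^ (2 * n + 1)) (at_inverse (St t)) 0 / fact (2 * n + 1)" for n
  have der: "((\<lambda>s. ?F (t(n := s))) has_field_derivative - (of_nat (2 * n + 1) * A n) / 2) (at (t n))" for n
    unfolding A_def by (rule DERIV_cdivide[OF beltrami_action_time_derivative[OF assms(3-6) t]])
  show "(\<lambda>s. ?F (t(n := s))) field_differentiable at (t n)"
    using der unfolding field_differentiable_def by blast
  have hol: "St t holomorphic_on - cball 0 1"
    and ser: "\<exists>c. \<forall>\<^sub>F z in at_infinity. (\<lambda>i. c i / z ^ Suc i) sums St t z"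
    and full_odd: "\<And>z. full_S St t (- z) = - full_S St t z"
    using assms(5) t by (auto simp: dBKP_beltrami_solution_def unit_disc_def)
  have "S0 t (- z) = - S0 t z" for z
    unfolding S0_def using assms(4) t by (subst suminf_minus[symmetric]) (auto simp: time_domain_def)
  then have odd: "St t (- z) = - St t z" for z
    using full_odd[of z] by (simp add: full_S_def)
  have hol_inv: "at_inverse (St t) holomorphic_on ball 0 1"
    using ser at_inverse_holomorphic[OF hol] by blast
  fix z :: complex assume z: "norm z > 1"
  then have "z \<noteq> 0" by auto
  \<comment> \<open>The weight \<open>1 / (2n+1)\<close> cancels the factor of the action
    derivative. The remaining \<open>- 1 / 2\<close> comes from halving the action and is undone by
    the 2 and the sign in front of the vertex operator.\<close>
  have "1 / (of_nat (2 * n + 1) * z ^ (2 * n + 1)) * time_deriv n ?F t = - (1 / 2) * (A n / z ^ (2 * n + 1))" for n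
  proof -
    have "time_deriv n ?F t = - (of_nat (2 * n + 1) * A n) / 2"
      unfolding time_deriv_def by (rule DERIV_imp_deriv[OF der])
    moreover have "(of_nat (2 * n + 1) :: complex) \<noteq> 0" by (simp only: of_nat_eq_0_iff)
    ultimately show ?thesis
      using \<open>z \<noteq> 0\<close> by (simp add: divide_simps del: of_nat_add of_nat_mult of_nat_Suc)
  qed
  moreover have "(\<lambda>n. - (1 / 2) * (A n / z ^ (2 * n + 1))) sums (- (1 / 2) * St t z)"
    unfolding A_def by (rule sums_mult[OF at_inverse_odd_sums[OF hol_inv odd z]])
  ultimately have sums: "(\<lambda>n. 1 / (of_nat (2 * n + 1) * z ^ (2 * n + 1)) * time_deriv n ?F t) sums
      (- (1 / 2) * St t z)"
    by (simp only:)
  then show "summable (\<lambda>n. 1 / (of_nat (2 * n + 1) * z ^ (2 * n + 1)) * time_deriv n ?F t)"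
    by (rule sums_summable)
  show "St t z = - B_vertex_operator z ?F t"
    unfolding B_vertex_operator_def sums_unique[OF sums, symmetric] by simp
qed

end
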